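(* Let $n\geq 1$, $\lambda>0$, and let $K\subset\mathbb{R}^{n+1}$ be a convex body. If $K$ is $\lambda$-concave, then $$(k-j)\frac{W_i(K)}{\lambda^{i}}+(i-k)\frac{W_j(K)}{\lambda^{j}}+(j-i)\frac{W_k(K)}{\lambda^{k}}\geq 0$$ for every triple of integers $(i,j,k)$ with $0\leq i<j<k\leq n+1$. Moreover, equality holds (for a given such triple) if and only if $K$ is a $\lambda$-sausage body.
   Context: A convex body is a compact convex set with non-empty interior; balls are closed. For $\lambda>0$, a convex body $K\subset\mathbb{R}^{n+1}$ is $\lambda$-concave if for every $p\in\partial K$ there is a ball $B_{1/\lambda,p}$ of radius $1/\lambda$ whose boundary passes through $p$ such that $B_{1/\lambda,p}\cap U(p)\subseteq K\cap U(p)$ for some open neighborhood $U(p)$ of $p$. A $\lambda$-sausage body is the convex hull of two (possibly coinciding) balls of radius $1/\lambda$. The quermassintegrals $W_i(K)$, $i=0,\dots,n+1$, are defined by the Steiner formula $\mathrm{Vol}_{n+1}(K+tB)=\sum_{i=0}^{n+1}\binom{n+1}{i}W_i(K)t^i$ for $t\geq 0$, where $B$ is the unit ball of $\mathbb{R}^{n+1}$ and $+$ is Minkowski addition. *)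

theory Defs
  imports "HOL-Analysis.Analysis"
begin

definition convex_body :: "'a::euclidean_space set \<Rightarrow> bool" where
  "convex_body K \<longleftrightarrow> convex K \<and> compact K \<and> interior K \<noteq> {}"

definition minkowski_sum :: "'a::euclidean_space set \<Rightarrow> 'a set \<Rightarrow> 'a set" where
  "minkowski_sum A B = {x + y | x y. x \<in> A \<and> y \<in> B}"

text \<open>Quermassintegrals via the Steiner formula: the unique coefficients W_0..W_d
  (d = ambient dimension, W_i = 0 for i > d) with
  Vol(K + tB) = sum_{i=0}^d (d choose i) W_i t^i for all t >= 0.\<close>
definition quermass :: "'a::euclidean_space set \<Rightarrow> nat \<Rightarrow> real" where
  "quermass K = (THE W. (\<forall>i>DIM('a). W i = 0) \<and>
     (\<forall>t\<ge>0. measure lebesgue (minkowski_sum K (cball 0 t)) =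
        (\<Sum>i\<le>DIM('a). real (DIM('a) choose i) * W i * t ^ i)))"

definition lambda_concave :: "real \<Rightarrow> 'a::euclidean_space set \<Rightarrow> bool" where
  "lambda_concave lam K \<longleftrightarrow> (\<forall>p\<in>frontier K. \<exists>c. dist c p = 1 / lam \<and>
     (\<exists>U. open U \<and> p \<in> U \<and> cball c (1 / lam) \<inter> U \<subseteq> K \<inter> U))"

definition lambda_sausage :: "real \<Rightarrow> 'a::euclidean_space set \<Rightarrow> bool" where
  "lambda_sausage lam K \<longleftrightarrow> (\<exists>a b. K = convex hull (cball a (1 / lam) \<union> cball b (1 / lam)))"

end

theory Submission
  imports Defs "HOL-Computational_Algebra.Polynomial"
begin

text \<open>
  Write \<open>r = 1 / \<lambda>\<close>, let \<open>B\<close> be the unit ball and \<open>d\<close> the dimension. The support function \<open>h\<close>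
  of a \<open>\<lambda>\<close>-concave body is such that \<open>h - r |\<cdot>|\<close> has local linear minorants, hence is convex, so
  \<open>K = L + r B\<close> with \<open>L\<close> compact and convex. If \<open>c\<^sub>m\<close> are the Steiner coefficients of \<open>L\<close>, then
  \<open>W\<^sub>i(K) / \<lambda>\<^sup>i\<close> is the sum over \<open>m\<close> of \<open>c\<^sub>m r\<^sup>m / (d choose m) \<cdot> ((d - i) choose (d - m))\<close>.
  As \<open>x \<mapsto> (x choose q)\<close> is convex, affine for \<open>q \<le> 1\<close> and strictly convex for \<open>q = 2\<close>, the inequality
  follows from \<open>c\<^sub>m \<ge> 0\<close>, with equality iff \<open>L\<close> is a segment: \<open>c\<^sub>m\<close> vanishes for \<open>m \<le> d - 2\<close> if \<open>L\<close>
  is a segment, and otherwise \<open>L\<close> contains a parallelogram, which forces \<open>c\<^sub>m > 0\<close> for \<open>m = d - 2\<close>.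

  For the Steiner formula, \<open>vol (A + s [0, u])\<close> is affine in \<open>s\<close>, so \<open>vol (A + t Z)\<close> is a polynomial
  in \<open>t\<close> with coefficients monotone in \<open>A\<close> for every zonotope \<open>Z\<close>; the ball is a limit of
  zonotopes.
\<close>

section \<open>Volumes of sums with zonotopes\<close>

text \<open>\<open>quermass\<close> is a definite description, so no quermassintegral can be
  evaluated before the Steiner polynomial is known to exist and to be unique. Segments are the
  convenient summands because max 0 (x . u) is the support function of [0, u]. The integral of this
  function over the unit ball depends only on |x|, so Riemann sums of that integral are support
  functions of zonotopes close to a ball. The number of segments, and with it the apparent degree,
  grows along the approximation; a limit of coefficients exists only after the growth in t has
  bounded the degree by d. Concavity is local while a Minkowski summand is global. For
  \<open>h - r |\<cdot>|\<close> the obstacle between the two is the origin, where no minorant is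
  available; segments through it are pushed aside, which takes a second dimension. The index d - 2
  enters because c_m is the coefficient of s^(d - m) in vol (s L + B): linear growth in s belongs to
  segments, quadratic growth to parallelograms.\<close>

abbreviation vol :: "'a::euclidean_space set \<Rightarrow> real" where
  "vol \<equiv> measure lebesgue"

lemma minkowski_sum_commute: "minkowski_sum A B = minkowski_sum B A"
  unfolding minkowski_sum_def by (metis add.commute)

lemma minkowski_sum_assoc:
  "minkowski_sum (minkowski_sum A B) C = minkowski_sum A (minkowski_sum B C)"
  unfolding minkowski_sum_def by (auto, (metis add.assoc)+)

lemma minkowski_sum_mono:
  "A \<subseteq> A' \<Longrightarrow> B \<subseteq> B' \<Longrightarrow> minkowski_sum A B \<subseteq> minkowski_sum A' B'"
  unfolding minkowski_sum_def by blast

lemma minkowski_sum_empty [simp]: "minkowski_sum {} B = {}" "minkowski_sum A {} = {}"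
  unfolding minkowski_sum_def by auto

lemma minkowski_sum_zero [simp]: "minkowski_sum A {0} = A" "minkowski_sum {0} A = A"
  unfolding minkowski_sum_def by auto

lemma minkowski_sum_scaleR:
  "(*\<^sub>R) t ` minkowski_sum A B = minkowski_sum ((*\<^sub>R) t ` A) ((*\<^sub>R) t ` B)"
  unfolding minkowski_sum_def image_def by (auto simp: scaleR_add_right) (metis scaleR_add_right)+

lemma minkowski_sum_translation:
  "minkowski_sum ((+) a ` A) B = (+) a ` minkowski_sum A B"
  unfolding minkowski_sum_def image_def by (auto simp: add.assoc) (metis add.assoc)+

lemma convex_minkowski_sum: "convex A \<Longrightarrow> convex B \<Longrightarrow> convex (minkowski_sum A B)"
proof -
  assume "convex A" "convex B"
  moreover have "minkowski_sum A B = (\<Union>x\<in>A. \<Union>y\<in>B. {x + y})"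
    unfolding minkowski_sum_def by blast
  ultimately show ?thesis using convex_sums[of A B] by simp
qed

lemma compact_minkowski_sum: "compact A \<Longrightarrow> compact B \<Longrightarrow> compact (minkowski_sum A B)"
  unfolding minkowski_sum_def by (rule compact_sums)

lemma minkowski_sum_cball:
  fixes c :: "'a::euclidean_space"
  assumes "0 \<le> s" "0 \<le> t"
  shows "minkowski_sum (cball c s) (cball 0 t) = cball c (s + t)"
proof (intro equalityI subsetI)
  fix x assume "x \<in> minkowski_sum (cball c s) (cball 0 t)"
  then obtain y z where yz: "x = y + z" "y \<in> cball c s" "z \<in> cball 0 t"
    unfolding minkowski_sum_def by blast
  then show "x \<in> cball c (s + t)"
    using norm_triangle_ineq[of "y - c" z]
    by (auto simp: dist_norm norm_minus_commute algebra_simps)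
next
  fix x assume x: "x \<in> cball c (s + t)"
  show "x \<in> minkowski_sum (cball c s) (cball 0 t)"
  proof (cases "s + t = 0")
    case True
    then have "s = 0" "t = 0" using assms by auto
    then show ?thesis using x by simp
  next
    case False
    define y where "y = c + (s / (s + t)) *\<^sub>R (x - c)"
    define z where "z = (t / (s + t)) *\<^sub>R (x - c)"
    have st: "s + t > 0" using False assms by linarith
    have n: "norm (x - c) \<le> s + t" using x by (simp add: dist_norm norm_minus_commute)
    have "y + z = c + ((s + t) / (s + t)) *\<^sub>R (x - c)"
      unfolding y_def z_def by (simp only: add_divide_distrib scaleR_add_left add.assoc)
    then have "x = y + z" using st by simp
    moreover have "(s / (s + t)) * norm (x - c) \<le> (s / (s + t)) * (s + t)"
      by (rule mult_left_mono[OF n]) (use assms st in auto)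
    then have "y \<in> cball c s"
      using st assms unfolding y_def by (simp add: dist_norm)
    moreover have "(t / (s + t)) * norm (x - c) \<le> (t / (s + t)) * (s + t)"
      by (rule mult_left_mono[OF n]) (use assms st in auto)
    then have "z \<in> cball 0 t"
      using st assms unfolding z_def by simp
    ultimately show ?thesis unfolding minkowski_sum_def by blast
  qed
qed

declare lmeasurable_compact [simp]

lemma vol_mono: "A \<subseteq> B \<Longrightarrow> compact A \<Longrightarrow> compact B \<Longrightarrow> vol A \<le> vol B"
  by (rule measure_mono_fmeasurable) (auto intro: fmeasurableD)

lemma vol_scaleR: "vol ((*\<^sub>R) t ` A) = \<bar>t\<bar> ^ DIM('a) * vol A" for A :: "'a::euclidean_space set"
  using measure_lebesgue_affine[of t 0 A] by simp

lemma vol_translation: "vol ((+) a ` A) = vol A"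
  using measure_translation by simp

text \<open>Cauchy's functional equation on the half-line. Additivity and nonnegativity make
  \<open>g\<close> monotone, so squeezing \<open>real n * s\<close> between consecutive integers
  bounds the error at \<open>s\<close> by g 1 / n for every positive n.\<close>

lemma additive_mono_linear:
  fixes g :: "real \<Rightarrow> real"
  assumes add: "\<And>s t. 0 \<le> s \<Longrightarrow> 0 \<le> t \<Longrightarrow> g (s + t) = g s + g t"
    and pos: "\<And>s. 0 \<le> s \<Longrightarrow> 0 \<le> g s" and s: "0 \<le> s"
  shows "g s = s * g 1"
proof -
  have mono: "g s \<le> g t" if "0 \<le> s" "s \<le> t" for s t
    using add[of s "t - s"] pos[of "t - s"] that by simp
  have nat: "g (real n * s) = real n * g s" if "0 \<le> s" for n s
  proof (induction n)
    case 0
    then show ?case using add[of 0 0] by simp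
  next
    case (Suc n)
    then show ?case using add[of "real n * s" s] that by (simp add: algebra_simps)
  qed
  have "\<bar>g s - s * g 1\<bar> * real n \<le> g 1" for n
  proof -
    define k where "k = nat \<lfloor>real n * s\<rfloor>"
    have k: "real k \<le> real n * s" "real n * s \<le> real k + 1"
      using s unfolding k_def by auto
    have "real k * g 1 \<le> real n * g s" "real n * g s \<le> (real k + 1) * g 1"
      using mono[OF _ k(1)] mono[OF _ k(2)] nat[OF s, of n] nat[of 1 k] nat[of 1 "Suc k"] s
      by (auto simp: add.commute)
    moreover have "real k * g 1 \<le> real n * s * g 1" "real n * s * g 1 \<le> (real k + 1) * g 1"
      using mult_right_mono[OF k(1) pos[of 1]] mult_right_mono[OF k(2) pos[of 1]] by auto
    ultimately have "\<bar>real n * g s - real n * s * g 1\<bar> \<le> g 1"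
      by (simp add: algebra_simps abs_le_iff)
    moreover have "real n * g s - real n * s * g 1 = (g s - s * g 1) * real n"
      by (simp add: algebra_simps)
    ultimately show ?thesis by (simp add: abs_mult)
  qed
  then have "\<not> 0 < \<bar>g s - s * g 1\<bar>"
    using reals_Archimedean3[of "\<bar>g s - s * g 1\<bar>"] by (metis mult.commute not_le)
  then show ?thesis by simp
qed

lemma closed_segment_0_scaleR:
  fixes u :: "'a::real_vector"
  assumes "0 \<le> s"
  shows "closed_segment 0 (s *\<^sub>R u) = {\<tau> *\<^sub>R u | \<tau>. 0 \<le> \<tau> \<and> \<tau> \<le> s}"
proof (cases "s = 0")
  case False
  then have "s > 0" using assms by simp
  show ?thesis
  proof (intro equalityI subsetI)
    fix x assume "x \<in> closed_segment 0 (s *\<^sub>R u)"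
    then obtain a where "0 \<le> a" "a \<le> 1" "x = (a * s) *\<^sub>R u" unfolding closed_segment_def by auto
    then show "x \<in> {\<tau> *\<^sub>R u | \<tau>. 0 \<le> \<tau> \<and> \<tau> \<le> s}" using \<open>s > 0\<close>
      by (auto intro!: exI[of _ "a * s"] mult_left_le_one_le)
  next
    fix x assume "x \<in> {\<tau> *\<^sub>R u | \<tau>. 0 \<le> \<tau> \<and> \<tau> \<le> s}"
    then obtain b where "0 \<le> b" "b \<le> s" "x = b *\<^sub>R u" by auto
    then show "x \<in> closed_segment 0 (s *\<^sub>R u)" using \<open>s > 0\<close>
      unfolding closed_segment_def by (auto intro!: exI[of _ "b / s"])
  qed
qed auto

text \<open>On every line in direction \<open>u\<close> the overlap of the two pieces of
  \<open>A + [0, (s + t) u]\<close> is a translate of the section of \<open>A\<close>; inclusion--exclusion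
  then makes the increment of the volume additive in the length of the segment.\<close>

lemma vol_add_segment_affine:
  fixes A :: "'a::euclidean_space set"
  assumes A: "compact A" "convex A" and s: "0 \<le> s"
  shows "vol (minkowski_sum A (closed_segment 0 (s *\<^sub>R u)))
     = vol A + s * (vol (minkowski_sum A (closed_segment 0 u)) - vol A)"
proof -
  define S where "S s = minkowski_sum A (closed_segment 0 (s *\<^sub>R u))" for s
  have S_eq: "S s = {a + \<tau> *\<^sub>R u | a \<tau>. a \<in> A \<and> 0 \<le> \<tau> \<and> \<tau> \<le> s}" if "0 \<le> s" for s
    unfolding S_def minkowski_sum_def closed_segment_0_scaleR[OF that] by auto
  have comp: "compact (S s)" for s
    unfolding S_def by (intro compact_minkowski_sum A compact_segment)
  have incl: "vol (S (s + t)) + vol A = vol (S s) + vol (S t)" if st: "0 \<le> s" "0 \<le> t" for s t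
  proof -
    have u: "S (s + t) = S s \<union> (+) (s *\<^sub>R u) ` S t"
    proof (intro equalityI subsetI)
      fix x assume "x \<in> S (s + t)"
      then obtain a \<tau> where x: "a \<in> A" "0 \<le> \<tau>" "\<tau> \<le> s + t" "x = a + \<tau> *\<^sub>R u"
        using S_eq st by auto
      show "x \<in> S s \<union> (+) (s *\<^sub>R u) ` S t"
      proof (cases "\<tau> \<le> s")
        case True
        then show ?thesis using x S_eq[OF st(1)] by auto
      next
        case False
        then have "a + (\<tau> - s) *\<^sub>R u \<in> S t" using x S_eq[OF st(2)]
          by (auto intro!: exI[of _ a] exI[of _ "\<tau> - s"])
        moreover have "x = s *\<^sub>R u + (a + (\<tau> - s) *\<^sub>R u)" using x by (simp add: algebra_simps)
        ultimately show ?thesis by blast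
      qed
    next
      fix x assume "x \<in> S s \<union> (+) (s *\<^sub>R u) ` S t"
      then consider a \<tau> where "a \<in> A" "0 \<le> \<tau>" "\<tau> \<le> s" "x = a + \<tau> *\<^sub>R u"
        | a \<tau> where "a \<in> A" "0 \<le> \<tau>" "\<tau> \<le> t" "x = s *\<^sub>R u + (a + \<tau> *\<^sub>R u)"
        using S_eq st by auto
      then show "x \<in> S (s + t)"
      proof cases
        case (1 a \<tau>)
        then show ?thesis using S_eq[of "s + t"] st by (auto intro!: exI[of _ a] exI[of _ \<tau>])
      next
        case (2 a \<tau>)
        then have "x = a + (s + \<tau>) *\<^sub>R u" by (simp add: algebra_simps)
        then show ?thesis using 2 S_eq[of "s + t"] st by (auto intro!: exI[of _ a] exI[of _ "s + \<tau>"])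
      qed
    qed
    have i: "S s \<inter> (+) (s *\<^sub>R u) ` S t = (+) (s *\<^sub>R u) ` A"
    proof (intro equalityI subsetI)
      fix x assume x: "x \<in> S s \<inter> (+) (s *\<^sub>R u) ` S t"
      then obtain a \<sigma> where a: "a \<in> A" "0 \<le> \<sigma>" "\<sigma> \<le> s" "x = a + \<sigma> *\<^sub>R u"
        using S_eq[OF st(1)] by auto
      obtain b \<tau> where b: "b \<in> A" "0 \<le> \<tau>" "\<tau> \<le> t" "x = s *\<^sub>R u + (b + \<tau> *\<^sub>R u)"
        using x S_eq[OF st(2)] by auto
      have ae: "a = (x - s *\<^sub>R u) + (s - \<sigma>) *\<^sub>R u" using a(4) by (simp add: algebra_simps)
      have be: "b = (x - s *\<^sub>R u) - \<tau> *\<^sub>R u" using b(4) by (simp add: algebra_simps)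
      \<comment> \<open>By \<open>ae\<close> and \<open>be\<close> this point lies on the line
        through \<open>a\<close> and \<open>b\<close>, at parameter distance
        \<open>s - \<sigma>\<close> from \<open>a\<close> and \<open>\<tau>\<close> from
        \<open>b\<close>, on opposite sides; this gives the convex weights below. If both distances
        vanish, the point is \<open>a\<close>.\<close>
      have "x - s *\<^sub>R u \<in> A"
      proof (cases "(s - \<sigma>) + \<tau> = 0")
        case True
        then have "s - \<sigma> = 0" using a b by linarith
        then show ?thesis using ae a(1) by simp
      next
        case False
        define D where "D = (s - \<sigma>) + \<tau>"
        have D: "D > 0" using False a b unfolding D_def by linarith
        have "(\<tau> / D) *\<^sub>R a + ((s - \<sigma>) / D) *\<^sub>R b \<in> A"
          using A(2) a(1) b(1) D a b unfolding D_def by (intro convexD) (auto simp: divide_simps)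
        moreover have "(\<tau> / D) *\<^sub>R a + ((s - \<sigma>) / D) *\<^sub>R b
           = (\<tau> / D + (s - \<sigma>) / D) *\<^sub>R (x - s *\<^sub>R u) + ((\<tau> / D) * (s - \<sigma>) - ((s - \<sigma>) / D) * \<tau>) *\<^sub>R u"
          unfolding ae be by (simp only: scaleR_add_right scaleR_diff_right scaleR_add_left scaleR_diff_left scaleR_scaleR) (simp add: algebra_simps diff_divide_distrib)
        moreover have "\<tau> / D + (s - \<sigma>) / D = 1" using D by (simp add: add_divide_distrib[symmetric] D_def)
        ultimately show ?thesis by simp
      qed
      then show "x \<in> (+) (s *\<^sub>R u) ` A" by (metis add.commute diff_add_cancel image_eqI)
    next
      fix x assume "x \<in> (+) (s *\<^sub>R u) ` A"
      then obtain a where a: "a \<in> A" "x = s *\<^sub>R u + a" by auto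
      have "x \<in> S s" using a st S_eq[OF st(1)] by (auto intro!: exI[of _ a] exI[of _ s])
      moreover have "a \<in> S t" using a st S_eq[OF st(2)] by (auto intro!: exI[of _ a] exI[of _ "0::real"])
      ultimately show "x \<in> S s \<inter> (+) (s *\<^sub>R u) ` S t" using a by auto
    qed
    have "vol (S s \<union> (+) (s *\<^sub>R u) ` S t)
        = vol (S s) + vol ((+) (s *\<^sub>R u) ` S t) - vol (S s \<inter> (+) (s *\<^sub>R u) ` S t)"
      by (rule measure_Un3) (intro lmeasurable_compact comp compact_translation)+
    then show ?thesis using u i vol_translation[of "s *\<^sub>R u"] by simp
  qed
  define g where "g s = vol (S s) - vol A" for s
  have "g s = s * g 1"
  proof (rule additive_mono_linear[OF _ _ s])
    fix s t :: real assume "0 \<le> s" "0 \<le> t"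
    then show "g (s + t) = g s + g t" unfolding g_def using incl[of s t] by simp
  next
    fix s :: real assume "0 \<le> s"
    then have "A \<subseteq> S s" using S_eq by (force intro!: exI[of _ "0::real"])
    then show "0 \<le> g s" unfolding g_def using vol_mono[OF _ A(1) comp] by simp
  qed
  then show ?thesis unfolding g_def S_def by simp
qed

text \<open>Segments start at the origin instead of being centred there, so that the support
  function is a sum of positive parts.\<close>

primrec zonotope :: "'a::euclidean_space list \<Rightarrow> 'a set" where
  "zonotope [] = {0}"
| "zonotope (u # us) = minkowski_sum (closed_segment 0 u) (zonotope us)"

lemma zonotope_compact_convex: "compact (zonotope us) \<and> convex (zonotope us)"
  by (induction us) (auto intro: compact_minkowski_sum convex_minkowski_sum)

lemma scaleR_zonotope_compact_convex:
  "compact ((*\<^sub>R) t ` zonotope us) \<and> convex ((*\<^sub>R) t ` zonotope us)"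
  using zonotope_compact_convex by (auto intro: compact_scaling convex_scaling)

lemma poly_eqI_nonneg:
  fixes p q :: "real poly"
  assumes "\<And>t. 0 \<le> t \<Longrightarrow> poly p t = poly q t"
  shows "p = q"
proof (rule ccontr)
  assume "p \<noteq> q"
  then have "finite {t. poly (p - q) t = 0}" by (intro poly_roots_finite) simp
  then have "finite {0::real..}" by (rule finite_subset[rotated]) (use assms in auto)
  then show False by (simp add: infinite_Ici)
qed

text \<open>Monotonicity of the coefficients in \<open>A\<close> is what survives the induction; positivity is
  the special case of the empty set.\<close>

lemma vol_add_zonotope_polynomial:
  "\<exists>\<Phi> :: 'a::euclidean_space set \<Rightarrow> real poly.
     (\<forall>A t. compact A \<and> convex A \<and> 0 \<le> t \<longrightarrow>
        vol (minkowski_sum A ((*\<^sub>R) t ` zonotope us)) = poly (\<Phi> A) t) \<and>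
     (\<forall>A A' i. compact A \<and> convex A \<and> compact A' \<and> convex A' \<and> A \<subseteq> A' \<longrightarrow>
        coeff (\<Phi> A) i \<le> coeff (\<Phi> A') i)"
proof (induction us)
  case Nil
  show ?case
    by (rule exI[of _ "\<lambda>A. [:vol A:]"]) (auto simp: coeff_pCons vol_mono split: nat.splits)
next
  case (Cons u us)
  then obtain \<Phi> :: "'a set \<Rightarrow> real poly"
    where \<Phi>: "\<forall>A t. compact A \<and> convex A \<and> 0 \<le> t \<longrightarrow>
        vol (minkowski_sum A ((*\<^sub>R) t ` zonotope us)) = poly (\<Phi> A) t"
      "\<forall>A A' i. compact A \<and> convex A \<and> compact A' \<and> convex A' \<and> A \<subseteq> A' \<longrightarrow>
        coeff (\<Phi> A) i \<le> coeff (\<Phi> A') i" by (elim exE conjE)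
  note P = \<Phi>(1)[rule_format, OF conjI, OF _ conjI]
    and M = \<Phi>(2)[rule_format, OF conjI, OF _ conjI, OF _ _ conjI, OF _ _ _ conjI]
  define E where "E A s = minkowski_sum A (closed_segment 0 (s *\<^sub>R u))" for A s
  have E: "compact (E A s)" "convex (E A s)" if "compact A" "convex A" for A s
    unfolding E_def using that by (auto intro: compact_minkowski_sum convex_minkowski_sum)
  define Q where "Q A = \<Phi> (E A 1) - \<Phi> A" for A
  \<comment> \<open>For fixed t, \<open>vol_add_segment_affine\<close> applies to A + t Z, since the
    segment and t Z may be added in either order. Agreement for all t \<ge> 0 then gives equality of
    polynomials.\<close>
  have lin: "\<Phi> (E A s) = \<Phi> A + smult s (Q A)" if A: "compact A" "convex A" "0 \<le> s" for A s
  proof (rule poly_eqI_nonneg)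
    fix t :: real assume t: "0 \<le> t"
    let ?Z = "(*\<^sub>R) t ` zonotope us"
    have sw: "minkowski_sum (E A s) ?Z = minkowski_sum (minkowski_sum A ?Z) (closed_segment 0 (s *\<^sub>R u))" for s
      unfolding E_def by (metis minkowski_sum_assoc minkowski_sum_commute)
    have AZ: "compact (minkowski_sum A ?Z)" "convex (minkowski_sum A ?Z)"
      using A scaleR_zonotope_compact_convex by (auto intro: compact_minkowski_sum convex_minkowski_sum)
    have "poly (\<Phi> (E A s)) t = poly (\<Phi> A) t + s * (poly (\<Phi> (E A 1)) t - poly (\<Phi> A) t)"
      using vol_add_segment_affine[OF AZ \<open>0 \<le> s\<close>, of u] P[OF E(1,2)[OF A(1,2)] t, of s, symmetric]
        P[OF E(1,2)[OF A(1,2)] t, of 1, symmetric] P[OF A(1,2) t, symmetric] sw[of s] sw[of 1] by simp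
    then show "poly (\<Phi> (E A s)) t = poly (\<Phi> A + smult s (Q A)) t" unfolding Q_def by simp
  qed
  show ?case
  \<comment> \<open>Scaling the longer zonotope by t scales the new segment too, so
    \<open>lin\<close> is used with s = t; the factor t before \<open>Q A\<close> becomes
    \<open>pCons 0\<close>.\<close>
  proof (rule exI[of _ "\<lambda>A. \<Phi> A + pCons 0 (Q A)"], intro conjI allI impI; elim conjE)
    fix A :: "'a set" and t :: real assume A: "compact A" "convex A" "0 \<le> t"
    have "closed_segment 0 (t *\<^sub>R u) = (*\<^sub>R) t ` closed_segment 0 u"
      using closed_segment_linear_image[of "(*\<^sub>R) t" 0 u] by (simp add: linear_scale_self)
    then have "minkowski_sum A ((*\<^sub>R) t ` zonotope (u # us)) = minkowski_sum (E A t) ((*\<^sub>R) t ` zonotope us)"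
      unfolding E_def by (simp add: minkowski_sum_scaleR minkowski_sum_assoc)
    then show "vol (minkowski_sum A ((*\<^sub>R) t ` zonotope (u # us))) = poly (\<Phi> A + pCons 0 (Q A)) t"
      using P[OF E(1,2)[OF A(1,2)] A(3), of t] lin[OF A] by simp
  next
    fix A A' :: "'a set" and i
    assume A: "compact A" "convex A" "compact A'" "convex A'" "A \<subseteq> A'"
    have le: "coeff (\<Phi> A) i + s * coeff (Q A) i \<le> coeff (\<Phi> A') i + s * coeff (Q A') i" if "0 \<le> s" for i s
    proof -
      have "E A s \<subseteq> E A' s" unfolding E_def by (rule minkowski_sum_mono) (use A in auto)
      then have "coeff (\<Phi> (E A s)) i \<le> coeff (\<Phi> (E A' s)) i" by (intro M E A)
      then show ?thesis using lin A that by simp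
    qed
    \<comment> \<open>An inequality between affine functions of s on the whole half-line passes to
      the slopes; otherwise it fails at the s below, where the slopes outweigh the gap of the
      intercepts.\<close>
    have "coeff (Q A) i \<le> coeff (Q A') i" for i
    proof (rule ccontr)
      assume "\<not> ?thesis"
      then have d: "coeff (Q A) i - coeff (Q A') i > 0" by simp
      define s where "s = (\<bar>coeff (\<Phi> A') i - coeff (\<Phi> A) i\<bar> + 1) / (coeff (Q A) i - coeff (Q A') i)"
      have "s * (coeff (Q A) i - coeff (Q A') i) = \<bar>coeff (\<Phi> A') i - coeff (\<Phi> A) i\<bar> + 1"
        using d unfolding s_def by simp
      moreover have "s \<ge> 0" using d unfolding s_def by simp
      ultimately show False using le[of s i] by (simp add: algebra_simps)
    qed
    then show "coeff (\<Phi> A + pCons 0 (Q A)) i \<le> coeff (\<Phi> A' + pCons 0 (Q A')) i"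
      using le[of 0 i] by (auto simp: coeff_pCons split: nat.splits intro!: add_mono)
  qed
qed

section \<open>The ball as a limit of zonotopes\<close>

lemma emeasure_ball_cong:
  "emeasure lborel (ball (a::'a::euclidean_space) r) = emeasure lborel (ball (b::'a) r)"
proof (cases "r \<ge> 0")
  case True then show ?thesis by (simp add: emeasure_ball)
next
  case False then show ?thesis by (simp add: ball_empty)
qed

lemma vimage_isometry_ball:
  fixes f :: "'a::euclidean_space \<Rightarrow> 'a"
  assumes iso: "\<And>x y. dist (f x) (f y) = dist x y" and inv: "\<And>x. f (f x) = x"
  shows "f -` ball a r = ball (f a) r"
  by (auto simp: vimage_def) (metis iso inv)+

text \<open>Vitali's theorem fills an open set with disjoint balls up to a null set, and an isometry
  preserves the volume of balls.\<close>

lemma emeasure_open_le_vimage_isometry: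
  fixes f :: "'a::euclidean_space \<Rightarrow> 'a"
  assumes iso: "\<And>x y. dist (f x) (f y) = dist x y" and inv: "\<And>x. f (f x) = x"
    and U: "open U"
  shows "emeasure lborel U \<le> emeasure lborel (f -` U)"
proof -
  have contf: "continuous_on UNIV f"
    unfolding continuous_on_iff using iso by metis
  have Uf: "open (f -` U)" using contf U by (metis continuous_on_open_vimage open_UNIV Int_UNIV_right)
  define I where "I = {(x, \<rho>). 0 < \<rho> \<and> ball x \<rho> \<subseteq> U}"
  have "\<exists>i. i \<in> I \<and> x \<in> ball (fst i) (snd i) \<and> snd i < d" if x: "x \<in> U" and d: "0 < d" for x and d :: real
  proof -
    obtain e where e: "e > 0" "ball x e \<subseteq> U" using U x open_contains_ball by metis
    have "(x, min e (d/2)) \<in> I" using e d unfolding I_def by auto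
    then show ?thesis using e d by (intro exI[of _ "(x, min e (d/2))"]) auto
  qed
  then obtain C where C: "countable C" "C \<subseteq> I"
     "pairwise (\<lambda>i j. disjnt (ball (fst i) (snd i)) (ball (fst j) (snd j))) C"
     "negligible (U - (\<Union>i \<in> C. ball (fst i) (snd i)))"
    by (rule Vitali_covering_theorem_balls[of U I fst snd]) blast
  let ?B = "\<lambda>i. ball (fst i) (snd i)"
  have bU: "open (\<Union>i\<in>C. ?B i)" by auto
  have sub: "(\<Union>i\<in>C. ?B i) \<subseteq> U" using C(2) unfolding I_def by fastforce
  have "emeasure lborel U = emeasure lborel (\<Union>i\<in>C. ?B i)"
  proof -
    have "U - (\<Union>i\<in>C. ?B i) \<in> null_sets lebesgue" using C(4) negligible_iff_null_sets by blast
    then have "U - (\<Union>i\<in>C. ?B i) \<in> null_sets lborel"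
      using U bU by (simp add: null_sets_def emeasure_completion) 
    moreover have eq: "(\<Union>i\<in>C. ?B i) \<union> (U - (\<Union>i\<in>C. ?B i)) = U" using sub by blast
    moreover have "(\<Union>i\<in>C. ?B i) \<in> sets lborel" using bU by simp
    ultimately have "emeasure lborel ((\<Union>i\<in>C. ?B i) \<union> (U - (\<Union>i\<in>C. ?B i))) = emeasure lborel (\<Union>i\<in>C. ?B i)"
      by (intro emeasure_Un_null_set)
    then show ?thesis unfolding eq .
  qed
  also have "\<dots> = (\<integral>\<^sup>+i. emeasure lborel (?B i) \<partial>count_space C)"
    by (rule emeasure_UN_countable) (use C in \<open>auto simp: pairwise_def disjoint_family_on_def disjnt_def\<close>)
  also have "\<dots> = (\<integral>\<^sup>+i. emeasure lborel (f -` ?B i) \<partial>count_space C)"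
    using vimage_isometry_ball[OF iso inv] emeasure_ball_cong by (metis (no_types, lifting))
  also have "\<dots> = emeasure lborel (\<Union>i\<in>C. f -` ?B i)"
  proof (rule emeasure_UN_countable[symmetric])
    have "f -` ?B i \<inter> f -` ?B j = {}" if "i \<in> C" "j \<in> C" "i \<noteq> j" for i j
      using C(3) that unfolding pairwise_def disjnt_def by (metis vimage_Int vimage_empty)
    then show "disjoint_family_on (\<lambda>i. f -` ?B i) C" unfolding disjoint_family_on_def by blast
  qed (use C in \<open>auto simp: vimage_isometry_ball[OF iso inv]\<close>)
  also have "\<dots> \<le> emeasure lborel (f -` U)"
    by (rule emeasure_mono) (use Uf sub in auto)
  finally show ?thesis .
qed

text \<open>Applying the one-sided estimate to both \<open>U\<close> and its preimage gives
  equality, because \<open>f\<close> undoes itself; boxes then determine the measure. Reflections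
  are of this kind.\<close>

lemma distr_lborel_involutive_isometry:
  fixes f :: "'a::euclidean_space \<Rightarrow> 'a"
  assumes iso: "\<And>x y. dist (f x) (f y) = dist x y" and inv: "\<And>x. f (f x) = x"
  shows "distr lborel borel f = lborel"
proof -
  have contf: "continuous_on UNIV f"
    unfolding continuous_on_iff using iso by metis
  then have meas: "f \<in> borel_measurable borel" by (rule borel_measurable_continuous_onI)
  have eq: "emeasure lborel (f -` U) = emeasure lborel U" if U: "open U" for U
  proof (rule antisym)
    have Uf: "open (f -` U)" using contf U by (metis continuous_on_open_vimage open_UNIV Int_UNIV_right)
    have "f -` (f -` U) = U" using inv by auto
    then show "emeasure lborel (f -` U) \<le> emeasure lborel U"
      using emeasure_open_le_vimage_isometry[OF iso inv Uf] by simp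
    show "emeasure lborel U \<le> emeasure lborel (f -` U)"
      by (rule emeasure_open_le_vimage_isometry[OF iso inv U])
  qed
  show ?thesis
  proof (rule lborel_eqI[symmetric])
    fix l u :: 'a assume "\<And>b. b \<in> Basis \<Longrightarrow> l \<bullet> b \<le> u \<bullet> b"
    then show "emeasure (distr lborel borel f) (box l u) = (\<Prod>b\<in>Basis. (u - l) \<bullet> b)"
      using eq[OF open_box, of l u] emeasure_lborel_box[of l u] meas by (simp add: emeasure_distr)
  qed simp
qed

section \<open>The norm as an integral of support functions of segments\<close>

definition pos_part_integral :: "'a::euclidean_space \<Rightarrow> 'a set \<Rightarrow> real" where
  "pos_part_integral x S = (\<integral>u. indicator S u * max 0 (x \<bullet> u) \<partial>lborel)"

lemma integrable_pos_part_integral: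
  fixes x :: "'a::euclidean_space"
  assumes "S \<in> sets borel" "S \<subseteq> cball 0 1"
  shows "integrable lborel (\<lambda>u. indicator S u * max 0 (x \<bullet> u))"
proof -
  have "integrable lborel (\<lambda>u. indicator (cball 0 1) u *\<^sub>R max 0 (x \<bullet> u))"
    by (rule borel_integrable_compact) (auto intro!: continuous_intros)
  then show ?thesis
    by (rule Bochner_Integration.integrable_bound)
       (use assms in \<open>auto simp: indicator_def split: if_splits intro!: AE_I2\<close>)
qed

text \<open>The reflection in the hyperplane orthogonal to x - y exchanges the two vectors and
  preserves both the ball and Lebesgue measure.\<close>

lemma pos_part_integral_reflection:
  fixes x y :: "'a::euclidean_space"
  assumes "norm x = norm y"
  shows "pos_part_integral x (cball 0 1) = pos_part_integral y (cball 0 1)"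
proof (cases "x = y")
  case False
  define v where "v = x - y"
  define f where "f z = z - (2 * (z \<bullet> v) / (v \<bullet> v)) *\<^sub>R v" for z
  have vv: "v \<bullet> v \<noteq> 0" using False unfolding v_def by simp
  have sym: "f a \<bullet> b = a \<bullet> f b" for a b
    unfolding f_def by (simp add: inner_diff_left inner_diff_right inner_commute)
  have inv: "f (f z) = z" for z
    unfolding f_def using vv by (simp add: inner_diff_left field_simps)
  have diff: "f a - f b = f (a - b)" for a b
    unfolding f_def by (simp add: inner_diff_left algebra_simps diff_divide_distrib)
  have nrm: "norm (f a) = norm a" for a
    unfolding norm_eq_sqrt_inner using sym[of a "f a"] inv by simp
  have iso: "dist (f a) (f b) = dist a b" for a b
    unfolding dist_norm diff nrm ..
  have xx: "x \<bullet> x = y \<bullet> y" using assms by (simp add: norm_eq)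
  have "2 * (x \<bullet> v) = v \<bullet> v"
    using xx unfolding v_def by (simp add: inner_diff_left inner_diff_right inner_commute)
  then have fx: "f x = y" unfolding f_def using vv by (simp add: v_def)
  have contf: "continuous_on UNIV f"
    unfolding continuous_on_iff using iso by metis
  then have meas: "f \<in> borel_measurable borel" by (rule borel_measurable_continuous_onI)
  have "pos_part_integral x (cball 0 1) = (\<integral>u. indicator (cball 0 1) u * max 0 (x \<bullet> u) \<partial>distr lborel borel f)"
    unfolding pos_part_integral_def distr_lborel_involutive_isometry[OF iso inv] ..
  also have "\<dots> = (\<integral>u. indicator (cball 0 1) (f u) * max 0 (x \<bullet> f u) \<partial>lborel)"
    by (rule integral_distr) (use meas in \<open>auto intro!: borel_measurable_times borel_measurable_max borel_measurable_indicator\<close>)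
  also have "\<dots> = pos_part_integral y (cball 0 1)"
    unfolding pos_part_integral_def by (rule Bochner_Integration.integral_cong) (auto simp: indicator_def nrm sym[symmetric] fx)
  finally show ?thesis .
qed simp

lemma pos_part_integral_scaleR: "0 \<le> t \<Longrightarrow> pos_part_integral (t *\<^sub>R x) S = t * pos_part_integral x S"
proof -
  assume t: "0 \<le> t"
  have "max 0 (t * a) = t * max 0 a" for a :: real
    using t by (auto simp: max_def mult_le_0_iff zero_le_mult_iff)
  then have "indicator S u * max 0 ((t *\<^sub>R x) \<bullet> u) = t * (indicator S u * max 0 (x \<bullet> u))" for u by simp
  then have "pos_part_integral (t *\<^sub>R x) S = (\<integral>u. t * (indicator S u * max 0 (x \<bullet> u)) \<partial>lborel)"
    unfolding pos_part_integral_def by (rule Bochner_Integration.integral_cong[OF refl])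
  then show ?thesis unfolding pos_part_integral_def by simp
qed

lemma pos_part_integral_eq_norm:
  "\<exists>c>0. \<forall>x::'a::euclidean_space. pos_part_integral x (cball 0 1) = c * norm x"
proof -
  obtain e :: 'a where e: "e \<in> Basis" using nonempty_Basis by blast
  define c where "c = pos_part_integral e (cball 0 1)"
  have "pos_part_integral x (cball 0 1) = c * norm x" for x :: 'a
  proof -
    have "pos_part_integral x (cball 0 1) = pos_part_integral (norm x *\<^sub>R e) (cball 0 1)"
      by (rule pos_part_integral_reflection) (use e in simp)
    then show ?thesis using pos_part_integral_scaleR[of "norm x" e] unfolding c_def by simp
  qed
  moreover have "c > 0"
  proof -
    \<comment> \<open>A ball inside the unit ball on which e . u \<ge> 1/4; it bounds
      \<open>c\<close> below by a quarter of its volume.\<close>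
    define S where "S = cball ((1/2) *\<^sub>R e) (1/4)"
    have S: "1/4 \<le> e \<bullet> u \<and> norm u \<le> 1" if "u \<in> S" for u
    proof -
      have n: "norm (u - (1/2) *\<^sub>R e) \<le> 1/4" using that unfolding S_def by (simp add: dist_norm norm_minus_commute)
      have "\<bar>e \<bullet> (u - (1/2) *\<^sub>R e)\<bar> \<le> 1 * (1/4)"
        using Cauchy_Schwarz_ineq2[of e "u - (1/2) *\<^sub>R e"] n e by simp
      then have "1/2 - e \<bullet> u \<le> 1/4" using abs_ge_minus_self[of "e \<bullet> u - 1/2"] e unfolding inner_diff_right inner_scaleR_right by (simp add: inner_Basis)
      then have "1/4 \<le> e \<bullet> u" by simp
      moreover have "norm u \<le> norm (u - (1/2) *\<^sub>R e) + norm ((1/2) *\<^sub>R e)"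
        using norm_triangle_ineq[of "u - (1/2) *\<^sub>R e" "(1/2) *\<^sub>R e"] by simp
      ultimately show ?thesis using n e by simp
    qed
    have "0 < measure lborel S * (1/4)"
      unfolding S_def by (simp add: content_cball)
    also have "\<dots> = (\<integral>u. indicator S u * (1/4) \<partial>lborel)"
      by simp
    also have "\<dots> \<le> c"
      unfolding c_def pos_part_integral_def
    proof (rule integral_mono)
      show "integrable lborel (\<lambda>u. indicat_real S u * (1/4))"
        unfolding S_def by (simp add: emeasure_cball)
      show "integrable lborel (\<lambda>u. indicator (cball 0 1) u * max 0 (e \<bullet> u))"
        by (rule integrable_pos_part_integral) auto
      fix u show "indicator S u * (1/4) \<le> indicator (cball 0 1) u * max 0 (e \<bullet> u)"
        using S[of u] by (auto simp: indicator_def)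
    qed
    finally show ?thesis .
  qed
  ultimately show ?thesis by blast
qed

abbreviation zonotope_support :: "'a::euclidean_space list \<Rightarrow> 'a \<Rightarrow> real" where
  "zonotope_support us x \<equiv> (\<Sum>u\<leftarrow>us. max 0 (x \<bullet> u))"

text \<open>Each induction step cuts off the part \<open>T\<close> of \<open>S\<close> in one
  covering ball and concentrates its mass at the centre. As max 0 is 1-Lipschitz, this costs at most
  \<delta> |x| times the volume of \<open>T\<close>, and the volumes of the disjoint pieces add
  up.\<close>

lemma pos_part_integral_riemann_sum:
  fixes xs :: "'a::euclidean_space list"
  assumes "S \<in> sets borel" "S \<subseteq> cball 0 1" "S \<subseteq> (\<Union>x\<in>set xs. ball x \<delta>)"
  shows "\<exists>us. \<forall>x. \<bar>pos_part_integral x S - zonotope_support us x\<bar> \<le> \<delta> * norm x * measure lborel S"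
  using assms
proof (induction xs arbitrary: S)
  case Nil
  then have "S = {}" by auto
  then show ?case by (intro exI[of _ "[]"]) (simp add: pos_part_integral_def)
next
  case (Cons a xs)
  define T where "T = S \<inter> ball a \<delta>"
  have fin: "X \<in> fmeasurable lborel" if "X \<in> sets borel" "X \<subseteq> cball 0 1" for X :: "'a set"
    by (rule fmeasurableI2[of "cball 0 1"]) (use that in \<open>auto simp: fmeasurable_def emeasure_cball\<close>)
  have T: "T \<in> sets borel" "T \<subseteq> cball 0 1" "S - T \<in> sets borel" "S - T \<subseteq> cball 0 1"
    using Cons.prems unfolding T_def by auto
  have "S - T \<subseteq> (\<Union>x\<in>set xs. ball x \<delta>)" using Cons.prems unfolding T_def by auto
  then obtain us where us: "\<And>x. \<bar>pos_part_integral x (S - T) - zonotope_support us x\<bar> \<le> \<delta> * norm x * measure lborel (S - T)"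
    using Cons.IH[OF T(3,4)] by blast
  have split: "pos_part_integral x S = pos_part_integral x T + pos_part_integral x (S - T)" for x
  proof -
    have "indicator S u * max 0 (x \<bullet> u) = indicator T u * max 0 (x \<bullet> u) + indicator (S - T) u * max 0 (x \<bullet> u)" for u :: 'a
      unfolding T_def by (auto simp: indicator_def)
    then show ?thesis unfolding pos_part_integral_def
      using Bochner_Integration.integral_add[OF integrable_pos_part_integral[OF T(1,2), of x] integrable_pos_part_integral[OF T(3,4), of x]] by simp
  qed
  have msplit: "measure lborel S = measure lborel T + measure lborel (S - T)"
  proof -
    have "measure lborel (T \<union> (S - T)) = measure lborel T + measure lborel (S - T)"
      by (rule measure_Un2[THEN trans]) (use fin T in \<open>auto simp: Diff_Diff_Int\<close>)
    moreover have "T \<union> (S - T) = S" unfolding T_def by blast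
    ultimately show ?thesis by simp
  qed
  define v where "v = measure lborel T *\<^sub>R a"
  have piece: "\<bar>pos_part_integral x T - max 0 (x \<bullet> v)\<bar> \<le> \<delta> * norm x * measure lborel T" for x
  proof -
    have iT: "integrable lborel (\<lambda>u. indicator T u * k)" for k :: real
      using fin[OF T(1,2)] by (simp add: fmeasurable_def)
    have "max 0 (x \<bullet> v) = measure lborel T * max 0 (x \<bullet> a)"
      unfolding v_def by (auto simp: max_def mult_le_0_iff zero_le_mult_iff not_le) (smt (verit) measure_nonneg mult_nonneg_nonneg)+
    also have "\<dots> = (\<integral>u. indicator T u * max 0 (x \<bullet> a) \<partial>lborel)" by simp
    finally have "pos_part_integral x T - max 0 (x \<bullet> v)
       = (\<integral>u. indicator T u * max 0 (x \<bullet> u) - indicator T u * max 0 (x \<bullet> a) \<partial>lborel)"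
      unfolding pos_part_integral_def
      using Bochner_Integration.integral_diff[OF integrable_pos_part_integral[OF T(1,2), of x] iT[of "max 0 (x \<bullet> a)"]] by simp
    moreover have "norm (\<integral>u. indicator T u * max 0 (x \<bullet> u) - indicator T u * max 0 (x \<bullet> a) \<partial>lborel)
       \<le> (\<integral>u. indicator T u * (\<delta> * norm x) \<partial>lborel)"
    proof (rule order_trans[OF integral_norm_bound integral_mono])
      show "integrable lborel (\<lambda>u. norm (indicator T u * max 0 (x \<bullet> u) - indicator T u * max 0 (x \<bullet> a)))"
        by (intro integrable_norm Bochner_Integration.integrable_diff integrable_pos_part_integral T iT)
      fix u
      show "norm (indicator T u * max 0 (x \<bullet> u) - indicator T u * max 0 (x \<bullet> a)) \<le> indicator T u * (\<delta> * norm x)"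
      proof (cases "u \<in> T")
        case True
        then have "norm (u - a) \<le> \<delta>" unfolding T_def by (auto simp: dist_norm norm_minus_commute)
        then have "norm x * norm (u - a) \<le> norm x * \<delta>" by (rule mult_left_mono) simp
        then have "\<bar>x \<bullet> (u - a)\<bar> \<le> norm x * \<delta>" using Cauchy_Schwarz_ineq2[of x "u - a"] by linarith
        then show ?thesis using True by (auto simp: inner_diff_right mult.commute)
      qed simp
    qed (rule iT)
    ultimately show ?thesis by (simp add: mult.commute)
  qed
  show ?case
  proof (intro exI[of _ "v # us"] allI)
    fix x
    have "\<bar>pos_part_integral x S - zonotope_support (v # us) x\<bar>
        \<le> \<bar>pos_part_integral x T - max 0 (x \<bullet> v)\<bar> + \<bar>pos_part_integral x (S - T) - zonotope_support us x\<bar>"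
      unfolding split by simp
    also have "\<dots> \<le> \<delta> * norm x * measure lborel T + \<delta> * norm x * measure lborel (S - T)"
      by (intro add_mono piece us)
    finally show "\<bar>pos_part_integral x S - zonotope_support (v # us) x\<bar> \<le> \<delta> * norm x * measure lborel S"
      unfolding msplit by (simp add: algebra_simps)
  qed
qed

lemma zonotope_inner_le: "z \<in> zonotope us \<Longrightarrow> x \<bullet> z \<le> zonotope_support us x"
proof (induction us arbitrary: z)
  case (Cons u us)
  then obtain a y where z: "z = a *\<^sub>R u + y" "0 \<le> a" "a \<le> 1" "y \<in> zonotope us"
    by (auto simp: minkowski_sum_def closed_segment_def)
  have "a * (x \<bullet> u) \<le> a * max 0 (x \<bullet> u)" using z by (intro mult_left_mono) auto
  also have "\<dots> \<le> max 0 (x \<bullet> u)" using z by (intro mult_left_le_one_le) auto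
  finally show ?case using Cons.IH[OF z(4)] z(1) by (simp add: inner_add_right)
qed simp

lemma zonotope_inner_attained: "\<exists>z\<in>zonotope us. x \<bullet> z = zonotope_support us x"
proof (induction us)
  case (Cons u us)
  then obtain y where y: "y \<in> zonotope us" "x \<bullet> y = zonotope_support us x" by blast
  define w where "w = (if x \<bullet> u > 0 then u else 0)"
  have "w \<in> closed_segment 0 u" unfolding w_def by auto
  then have "w + y \<in> zonotope (u # us)" using y by (auto simp: minkowski_sum_def)
  moreover have "x \<bullet> (w + y) = zonotope_support (u # us) x"
    using y unfolding w_def by (auto simp: inner_add_right)
  ultimately show ?case by blast
qed simp

text \<open>Comparing support functions decides inclusion of closed convex sets; the inner ball
  takes a separating hyperplane. For negative \<open>a\<close> that ball is empty.\<close>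

lemma zonotope_between_balls:
  assumes "\<And>x::'a::euclidean_space. a * norm x \<le> zonotope_support us x" "\<And>x. zonotope_support us x \<le> b * norm x"
  shows "cball 0 a \<subseteq> zonotope us" "zonotope us \<subseteq> cball 0 b"
proof -
  show "zonotope us \<subseteq> cball 0 b"
  proof
    fix z assume z: "z \<in> zonotope us"
    have "norm z * norm z \<le> b * norm z"
      using zonotope_inner_le[OF z, of z] assms(2)[of z] by (simp add: dot_square_norm power2_eq_square)
    moreover have "0 \<le> b" 
    proof -
      obtain e :: 'a where "e \<in> Basis" using nonempty_Basis by blast
      moreover have "0 \<le> zonotope_support us e" by (intro sum_list_nonneg) auto
      ultimately show ?thesis using assms(2)[of e] by simp
    qed
    ultimately show "z \<in> cball 0 b" by (cases "z = 0") auto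
  qed
  show "cball 0 a \<subseteq> zonotope us"
  proof
    fix y :: 'a assume y: "y \<in> cball 0 a"
    show "y \<in> zonotope us"
    proof (rule ccontr)
      assume "y \<notin> zonotope us"
      then obtain w \<beta> where w: "w \<bullet> y < \<beta>" "\<And>z. z \<in> zonotope us \<Longrightarrow> \<beta> < w \<bullet> z"
        using separating_hyperplane_closed_point[of "zonotope us" y] zonotope_compact_convex[of us] compact_imp_closed by blast
      obtain z where z: "z \<in> zonotope us" "(- w) \<bullet> z = zonotope_support us (- w)"
        using zonotope_inner_attained by blast
      have "a * norm w \<le> - (w \<bullet> z)" using assms(1)[of "- w"] z by simp
      also have "\<dots> < - (w \<bullet> y)" using w z by force
      also have "\<dots> \<le> norm w * norm y" using Cauchy_Schwarz_ineq2[of w y] by linarith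
      also have "\<dots> \<le> norm w * a" using y by (intro mult_left_mono) auto
      finally show False by (simp add: mult.commute)
    qed
  qed
qed

lemma zonotope_approximates_ball:
  assumes "0 < (\<epsilon>::real)"
  shows "\<exists>us. cball (0::'a::euclidean_space) (1 - \<epsilon>) \<subseteq> zonotope us \<and> zonotope us \<subseteq> cball 0 (1 + \<epsilon>)"
proof -
  obtain c where c: "c > 0" "\<And>x::'a. pos_part_integral x (cball 0 1) = c * norm x"
    using pos_part_integral_eq_norm by blast
  define m where "m = measure lborel (cball (0::'a) 1)"
  have m: "m > 0" unfolding m_def by (simp add: content_cball)
  \<comment> \<open>Chosen so that the error \<open>\<delta> * m\<close> turns into
    \<open>\<epsilon>\<close> once the support function is divided by \<open>c\<close>.\<close>
  define \<delta> where "\<delta> = \<epsilon> * c / m"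
  have \<delta>: "\<delta> > 0" using c m assms unfolding \<delta>_def by simp
  obtain F where F: "finite F" "cball (0::'a) 1 \<subseteq> (\<Union>x\<in>F. ball x \<delta>)"
    by (rule compactE_image[of "cball (0::'a) 1" "cball 0 1" "\<lambda>x. ball x \<delta>"]) (use \<delta> in auto)
  obtain xs where xs: "set xs = F" using F finite_list by blast
  have "\<exists>us. \<forall>x::'a. \<bar>pos_part_integral x (cball 0 1) - zonotope_support us x\<bar> \<le> \<delta> * norm x * measure lborel (cball (0::'a) 1)"
    by (rule pos_part_integral_riemann_sum[where xs = xs]) (use F xs in auto)
  then obtain us where us: "\<And>x::'a. \<bar>c * norm x - zonotope_support us x\<bar> \<le> \<delta> * norm x * m"
    unfolding c(2) m_def by blast
  define vs where "vs = map ((*\<^sub>R) (1 / c)) us"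
  have vs: "zonotope_support vs x = zonotope_support us x / c" for x
  proof -
    have "max 0 (a / c) = max 0 a / c" for a
      using c(1) by (simp add: max_def divide_le_0_iff zero_le_divide_iff)
    then show ?thesis unfolding vs_def by (induction us) (simp_all add: add_divide_distrib)
  qed
  have "\<bar>norm x - zonotope_support vs x\<bar> \<le> \<epsilon> * norm x" for x :: 'a
  proof -
    have "c * (norm x - zonotope_support vs x) = c * norm x - zonotope_support us x"
      unfolding vs using c(1) by (simp add: algebra_simps)
    then have "\<bar>c * (norm x - zonotope_support vs x)\<bar> \<le> \<delta> * norm x * m" using us[of x] by simp
    also have "\<dots> = c * (\<epsilon> * norm x)" using m unfolding \<delta>_def by simp
    finally have "c * \<bar>norm x - zonotope_support vs x\<bar> \<le> c * (\<epsilon> * norm x)"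
      using c(1) by (simp add: abs_mult)
    then show ?thesis using c(1) by simp
  qed
  then have "(1 - \<epsilon>) * norm x \<le> zonotope_support vs x" "zonotope_support vs x \<le> (1 + \<epsilon>) * norm x" for x :: 'a
    unfolding left_diff_distrib distrib_right abs_le_iff mult_1_left by (simp_all add: algebra_simps)
  then show ?thesis using zonotope_between_balls[of "1 - \<epsilon>" vs "1 + \<epsilon>"] by blast
qed

section \<open>The Steiner polynomial\<close>

lemma coeff_mult_power_le_poly:
  fixes p :: "real poly"
  assumes "\<And>i. 0 \<le> coeff p i" "0 \<le> t"
  shows "coeff p m * t ^ m \<le> poly p t"
proof (cases "m \<le> degree p")
  case True
  have "coeff p m * t ^ m \<le> (\<Sum>i\<le>degree p. coeff p i * t ^ i)"
    using True assms by (intro member_le_sum) auto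
  then show ?thesis by (simp add: poly_altdef)
next
  case False
  then have "coeff p m = 0" by (simp add: coeff_eq_0)
  moreover have "0 \<le> poly p t" unfolding poly_altdef using assms by (intro sum_nonneg) auto
  ultimately show ?thesis by simp
qed

text \<open>Nonnegative coefficients exclude cancellation, so each single term is bounded by the
  polynomial, and a term of order above \<open>d\<close> breaks the bound at a large t.\<close>

lemma nonneg_coeff_eq_0_of_growth:
  fixes p :: "real poly"
  assumes nn: "\<And>i. 0 \<le> coeff p i" and bd: "\<And>t. 1 \<le> t \<Longrightarrow> poly p t \<le> C * t ^ d" and m: "d < m"
  shows "coeff p m = 0"
proof (rule ccontr)
  assume "coeff p m \<noteq> 0"
  then have pos: "coeff p m > 0" using nn[of m] by simp
  define t where "t = max 1 ((\<bar>C\<bar> + 1) / coeff p m)"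
  have t: "1 \<le> t" unfolding t_def by simp
  have "(coeff p m * t) * t ^ d = coeff p m * t ^ Suc d" by simp
  also have "\<dots> \<le> coeff p m * t ^ m"
    using t m pos by (intro mult_left_mono power_increasing) auto
  also have "\<dots> \<le> C * t ^ d" using coeff_mult_power_le_poly[OF nn, of t m] bd[OF t] t by linarith
  finally have "coeff p m * t \<le> C" using t by simp
  moreover have "\<bar>C\<bar> + 1 \<le> coeff p m * t"
    using pos by (auto simp: t_def max_def field_simps split: if_splits)
  ultimately show False by linarith
qed

section \<open>Interpolation at the nodes 0, ..., d\<close>

definition lagrange :: "nat \<Rightarrow> nat \<Rightarrow> real poly" where
  "lagrange d j = (\<Prod>i\<in>{..d} - {j}. smult (1 / (real j - real i)) [:- real i, 1:])"

lemma poly_lagrange: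
  assumes "k \<le> d" "j \<le> d"
  shows "poly (lagrange d j) (real k) = (if k = j then 1 else 0)"
proof (cases "k = j")
  case True
  then show ?thesis unfolding lagrange_def poly_prod by (auto intro!: prod.neutral simp: diff_divide_distrib[symmetric])
next
  case False
  then show ?thesis using assms unfolding lagrange_def poly_prod by (auto intro!: bexI[of _ k])
qed

lemma degree_lagrange: "j \<le> d \<Longrightarrow> degree (lagrange d j) \<le> d"
proof -
  assume "j \<le> d"
  have "degree (lagrange d j) \<le> (\<Sum>i\<in>{..d} - {j}. degree (smult (1 / (real j - real i)) [:- real i, 1:]))"
    unfolding lagrange_def 
    by (rule degree_prod_sum_le[of "{..d} - {j}", unfolded comp_def]) simp
  also have "\<dots> \<le> (\<Sum>i\<in>{..d} - {j}. 1)" by (rule sum_mono) (simp)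
  also have "\<dots> = d" using \<open>j \<le> d\<close> by simp
  finally show ?thesis .
qed

text \<open>Makes every coefficient a fixed linear combination of d + 1 values, so that pointwise
  limits become limits of coefficients.\<close>

lemma lagrange_interpolation:
  assumes "degree p \<le> d"
  shows "p = (\<Sum>j\<le>d. smult (poly p (real j)) (lagrange d j))"
proof (rule poly_eqI_degree[of "real ` {..d}"])
  have c: "card (real ` {..d}) = Suc d" by (subst card_image) (auto simp: inj_on_def)
  show "degree p < card (real ` {..d})" using assms c by simp
  have "degree (\<Sum>j\<le>d. smult (poly p (real j)) (lagrange d j)) \<le> d"
    by (rule degree_sum_le) (auto intro: degree_smult_le[THEN order_trans] degree_lagrange)
  then show "degree (\<Sum>j\<le>d. smult (poly p (real j)) (lagrange d j)) < card (real ` {..d})" using c by simp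
next
  fix x assume "x \<in> real ` {..d}"
  then obtain k where k: "k \<le> d" "x = real k" by auto
  have "poly (\<Sum>j\<le>d. smult (poly p (real j)) (lagrange d j)) x
      = (\<Sum>j\<le>d. poly p (real j) * (if k = j then 1 else 0))"
    unfolding poly_sum k by (rule sum.cong) (use k poly_lagrange in auto)
  also have "\<dots> = poly p x" using k by (simp add: sum.delta' if_distrib cong: if_cong)
  finally show "poly p x = poly (\<Sum>j\<le>d. smult (poly p (real j)) (lagrange d j)) x" by simp
qed

text \<open>If 0 is in A, then (1 - \<epsilon>) A \<subseteq> A \<subseteq> (1 + \<epsilon>) A, and
  t Z lies likewise between multiples of t B. Hence A + t Z lies between two homothets of A + t B,
  whose volumes carry the d-th powers. A translation brings 0 into a nonempty A.\<close>

lemma vol_add_between: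
  fixes A :: "'a::euclidean_space set"
  assumes A: "compact A" "convex A" and t: "0 \<le> t" and e: "0 < \<epsilon>" "\<epsilon> < 1"
    and Z: "cball 0 (1 - \<epsilon>) \<subseteq> Z" "Z \<subseteq> cball 0 (1 + \<epsilon>)" "compact Z"
  shows "(1 - \<epsilon>) ^ DIM('a) * vol (minkowski_sum A (cball 0 t)) \<le> vol (minkowski_sum A ((*\<^sub>R) t ` Z))"
    and "vol (minkowski_sum A ((*\<^sub>R) t ` Z)) \<le> (1 + \<epsilon>) ^ DIM('a) * vol (minkowski_sum A (cball 0 t))"
proof -
  have *: "(1 - \<epsilon>) ^ DIM('a) * vol (minkowski_sum A (cball 0 t)) \<le> vol (minkowski_sum A ((*\<^sub>R) t ` Z))
    \<and> vol (minkowski_sum A ((*\<^sub>R) t ` Z)) \<le> (1 + \<epsilon>) ^ DIM('a) * vol (minkowski_sum A (cball 0 t))"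
    if A: "compact A" "convex A" and 0: "0 \<in> A" for A
  proof
    have c1: "compact (minkowski_sum A (cball 0 t))" and c2: "compact (minkowski_sum A ((*\<^sub>R) t ` Z))"
      using A Z by (auto intro: compact_minkowski_sum compact_scaling)
    have "(*\<^sub>R) (1 - \<epsilon>) ` A \<subseteq> A"
      using convexD[OF A(2) _ 0, of _ "1 - \<epsilon>" \<epsilon>] e by auto
    moreover have "(*\<^sub>R) (1 - \<epsilon>) ` cball 0 t \<subseteq> (*\<^sub>R) t ` Z"
    proof (cases "t = 0")
      case True
      have "0 \<in> Z" using Z(1) e by auto
      then show ?thesis using True by (auto simp: image_iff)
    next
      case False
      have "(*\<^sub>R) (1 - \<epsilon>) ` cball 0 t = (*\<^sub>R) t ` cball (0::'a) (1 - \<epsilon>)"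
        using e t False cball_scale[of "1 - \<epsilon>" "0::'a" t] cball_scale[of t "0::'a" "1 - \<epsilon>"]
        by (simp add: mult.commute)
      then show ?thesis using Z(1) by auto
    qed
    ultimately have "(*\<^sub>R) (1 - \<epsilon>) ` minkowski_sum A (cball 0 t) \<subseteq> minkowski_sum A ((*\<^sub>R) t ` Z)"
      unfolding minkowski_sum_scaleR by (rule minkowski_sum_mono)
    from vol_mono[OF this compact_scaling[OF c1] c2]
    show "(1 - \<epsilon>) ^ DIM('a) * vol (minkowski_sum A (cball 0 t)) \<le> vol (minkowski_sum A ((*\<^sub>R) t ` Z))"
      using e by (simp add: vol_scaleR)
    have "A \<subseteq> (*\<^sub>R) (1 + \<epsilon>) ` A"
    proof
      fix x assume "x \<in> A"
      then have "(1 / (1 + \<epsilon>)) *\<^sub>R x + (\<epsilon> / (1 + \<epsilon>)) *\<^sub>R 0 \<in> A"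
        using A 0 e by (intro convexD) (auto simp: field_simps)
      then show "x \<in> (*\<^sub>R) (1 + \<epsilon>) ` A" using e by (intro image_eqI[of _ _ "(1 / (1 + \<epsilon>)) *\<^sub>R x"]) auto
    qed
    moreover have "(*\<^sub>R) t ` Z \<subseteq> (*\<^sub>R) (1 + \<epsilon>) ` cball 0 t"
    proof
      fix x assume "x \<in> (*\<^sub>R) t ` Z"
      then obtain z where z: "z \<in> Z" "x = t *\<^sub>R z" by auto
      have "t * norm z \<le> t * (1 + \<epsilon>)" using z Z t by (intro mult_left_mono) auto
      then show "x \<in> (*\<^sub>R) (1 + \<epsilon>) ` cball 0 t" using e t z
        by (intro image_eqI[of _ _ "(1 / (1 + \<epsilon>)) *\<^sub>R x"]) (auto simp: field_simps)
    qed
    ultimately have "minkowski_sum A ((*\<^sub>R) t ` Z) \<subseteq> (*\<^sub>R) (1 + \<epsilon>) ` minkowski_sum A (cball 0 t)"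
      unfolding minkowski_sum_scaleR by (rule minkowski_sum_mono)
    from vol_mono[OF this c2 compact_scaling[OF c1]]
    show "vol (minkowski_sum A ((*\<^sub>R) t ` Z)) \<le> (1 + \<epsilon>) ^ DIM('a) * vol (minkowski_sum A (cball 0 t))"
      using e by (simp add: vol_scaleR)
  qed
  have **: "(1 - \<epsilon>) ^ DIM('a) * vol (minkowski_sum A (cball 0 t)) \<le> vol (minkowski_sum A ((*\<^sub>R) t ` Z))
    \<and> vol (minkowski_sum A ((*\<^sub>R) t ` Z)) \<le> (1 + \<epsilon>) ^ DIM('a) * vol (minkowski_sum A (cball 0 t))"
  proof (cases "A = {}")
    case False
    then obtain a where a: "a \<in> A" by blast
    have "0 \<in> (+) (- a) ` A" using a by (auto simp: image_iff)
    from *[OF compact_translation[OF A(1)] convex_translation[OF A(2)] this]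
    show ?thesis unfolding minkowski_sum_translation vol_translation .
  qed simp
  show "(1 - \<epsilon>) ^ DIM('a) * vol (minkowski_sum A (cball 0 t)) \<le> vol (minkowski_sum A ((*\<^sub>R) t ` Z))"
    and "vol (minkowski_sum A ((*\<^sub>R) t ` Z)) \<le> (1 + \<epsilon>) ^ DIM('a) * vol (minkowski_sum A (cball 0 t))"
    using ** by auto
qed

text \<open>The polynomials of the approximating zonotopes get a common degree bound from their
  growth in t. Convergence at d + 1 nodes then forces convergence of all coefficients, and
  monotonicity in the body survives the limit.\<close>

lemma steiner_polynomial:
  "\<exists>\<Psi> :: 'a::euclidean_space set \<Rightarrow> real poly.
     (\<forall>A. compact A \<and> convex A \<longrightarrow> degree (\<Psi> A) \<le> DIM('a) \<and>
        (\<forall>t\<ge>0. vol (minkowski_sum A (cball 0 t)) = poly (\<Psi> A) t)) \<and>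
     (\<forall>A A' i. compact A \<and> convex A \<and> compact A' \<and> convex A' \<and> A \<subseteq> A' \<longrightarrow>
        coeff (\<Psi> A) i \<le> coeff (\<Psi> A') i)"
proof -
  define d where "d = DIM('a)"
  define V where "V A t = vol (minkowski_sum A (cball 0 t))" for A :: "'a set" and t
  \<comment> \<open>The shift by two keeps the value below 1 already at n = 0, as
    \<open>vol_add_between\<close> demands.\<close>
  define \<epsilon> where "\<epsilon> n = inverse (real (Suc (Suc n)))" for n
  have e: "0 < \<epsilon> n" "\<epsilon> n < 1" for n unfolding \<epsilon>_def by (auto simp: inverse_less_1_iff)
  have "\<exists>us. cball (0::'a) (1 - \<epsilon> n) \<subseteq> zonotope us \<and> zonotope us \<subseteq> cball 0 (1 + \<epsilon> n)" for n
    by (rule zonotope_approximates_ball) (rule e)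
  then obtain us where us: "\<And>n. cball (0::'a) (1 - \<epsilon> n) \<subseteq> zonotope (us n)" "\<And>n. zonotope (us n) \<subseteq> cball 0 (1 + \<epsilon> n)"
    by metis
  define Z where "Z n = zonotope (us n)" for n
  note ZZ = us[folded Z_def]
  have Zc: "compact (Z n)" for n unfolding Z_def using zonotope_compact_convex by blast
  obtain \<Phi> :: "nat \<Rightarrow> 'a set \<Rightarrow> real poly" where \<Phi>: "\<forall>n. (\<forall>A t. compact A \<and> convex A \<and> 0 \<le> t \<longrightarrow>
        vol (minkowski_sum A ((*\<^sub>R) t ` Z n)) = poly (\<Phi> n A) t) \<and>
     (\<forall>A A' i. compact A \<and> convex A \<and> compact A' \<and> convex A' \<and> A \<subseteq> A' \<longrightarrow>
        coeff (\<Phi> n A) i \<le> coeff (\<Phi> n A') i)"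
    using choice[OF allI[OF vol_add_zonotope_polynomial]] unfolding Z_def by fast
  have P: "vol (minkowski_sum A ((*\<^sub>R) t ` Z n)) = poly (\<Phi> n A) t"
    if "compact A" "convex A" "0 \<le> t" for n A t using \<Phi> that by simp
  have M: "coeff (\<Phi> n A) i \<le> coeff (\<Phi> n A') i"
    if "compact A" "convex A" "compact A'" "convex A'" "A \<subseteq> A'" for n A A' i using \<Phi> that by simp
  have "\<Phi> n {} = 0" for n
    by (rule poly_eqI_nonneg) (use P[of "{}"] in simp)
  then have nonneg: "0 \<le> coeff (\<Phi> n A) i" if "compact A" "convex A" for n A i
    using M[of "{}" A n i] that by simp
  have bounds: "(1 - \<epsilon> n) ^ d * V A t \<le> poly (\<Phi> n A) t" "poly (\<Phi> n A) t \<le> (1 + \<epsilon> n) ^ d * V A t"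
    if "compact A" "convex A" "0 \<le> t" for n A t
    using vol_add_between[OF that e ZZ Zc] P[OF that] unfolding V_def d_def by auto
  have deg: "degree (\<Phi> n A) \<le> d" if A: "compact A" "convex A" for n A
  proof (rule degree_le, intro allI impI)
    fix i assume i: "d < i"
    obtain R where R: "R > 0" "A \<subseteq> cball 0 R"
      using compact_imp_bounded[OF A(1)] 
      by (metis bounded_pos mem_cball_0 subsetI)
    show "coeff (\<Phi> n A) i = 0"
    proof (rule nonneg_coeff_eq_0_of_growth[OF nonneg[OF A] _ i])
      fix t :: real assume t: "1 \<le> t"
      have "V A t \<le> vol (minkowski_sum (cball 0 R) (cball (0::'a) t))"
        unfolding V_def by (intro vol_mono minkowski_sum_mono compact_minkowski_sum) (use R A in auto)
      also have "\<dots> \<le> vol (cball (0::'a) ((R + 1) * t))"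
        unfolding minkowski_sum_cball[OF less_imp_le[OF R(1)] order_trans[OF zero_le_one t]]
      proof (rule vol_mono)
        have "R + t \<le> (R + 1) * t" using R t by (simp add: algebra_simps)
        then show "cball (0::'a) (R + t) \<subseteq> cball 0 ((R + 1) * t)" by auto
      qed auto
      also have "\<dots> = (unit_ball_vol (real d) * (R + 1) ^ d) * t ^ d"
        using R t unfolding d_def by (simp add: content_cball power_mult_distrib)
      finally have "V A t \<le> (unit_ball_vol (real d) * (R + 1) ^ d) * t ^ d" .
      moreover have "poly (\<Phi> n A) t \<le> (1 + \<epsilon> n) ^ d * V A t" using bounds A t by simp
      ultimately show "poly (\<Phi> n A) t \<le> ((1 + \<epsilon> n) ^ d * (unit_ball_vol (real d) * (R + 1) ^ d)) * t ^ d"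
        using mult_left_mono[of "V A t" _ "(1 + \<epsilon> n) ^ d"] e[of n] by (smt (verit) mult.assoc zero_le_power)
    qed
  qed
  have "\<epsilon> \<longlonglongrightarrow> 0" unfolding \<epsilon>_def by (rule LIMSEQ_Suc[OF LIMSEQ_inverse_real_of_nat])
  have lim: "(\<lambda>n. poly (\<Phi> n A) t) \<longlonglongrightarrow> V A t" if A: "compact A" "convex A" "0 \<le> t" for A t
  proof (rule tendsto_sandwich)
    show "\<forall>\<^sub>F n in sequentially. (1 - \<epsilon> n) ^ d * V A t \<le> poly (\<Phi> n A) t"
      "\<forall>\<^sub>F n in sequentially. poly (\<Phi> n A) t \<le> (1 + \<epsilon> n) ^ d * V A t"
      using bounds[OF A] by auto
    have "(\<lambda>n. (1 - \<epsilon> n) ^ d * V A t) \<longlonglongrightarrow> (1 - 0) ^ d * V A t"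
      by (intro tendsto_intros \<open>\<epsilon> \<longlonglongrightarrow> 0\<close>)
    then show "(\<lambda>n. (1 - \<epsilon> n) ^ d * V A t) \<longlonglongrightarrow> V A t" by simp
    have "(\<lambda>n. (1 + \<epsilon> n) ^ d * V A t) \<longlonglongrightarrow> (1 + 0) ^ d * V A t"
      by (intro tendsto_intros \<open>\<epsilon> \<longlonglongrightarrow> 0\<close>)
    then show "(\<lambda>n. (1 + \<epsilon> n) ^ d * V A t) \<longlonglongrightarrow> V A t" by simp
  qed
  \<comment> \<open>The interpolation formula for \<open>\<Phi> n A\<close> with the node values
    replaced by their limits.\<close>
  define \<Psi> where "\<Psi> A = (\<Sum>j\<le>d. smult (V A (real j)) (lagrange d j))" for A
  have interp: "\<Phi> n A = (\<Sum>j\<le>d. smult (poly (\<Phi> n A) (real j)) (lagrange d j))" if "compact A" "convex A" for n A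
    by (rule lagrange_interpolation[OF deg[OF that]])
  have coeffs: "(\<lambda>n. coeff (\<Phi> n A) i) \<longlonglongrightarrow> coeff (\<Psi> A) i" if A: "compact A" "convex A" for A i
  proof -
    have "(\<lambda>n. \<Sum>j\<le>d. poly (\<Phi> n A) (real j) * coeff (lagrange d j) i) \<longlonglongrightarrow> (\<Sum>j\<le>d. V A (real j) * coeff (lagrange d j) i)"
      by (intro tendsto_intros lim A) simp
    moreover have "coeff (\<Phi> n A) i = (\<Sum>j\<le>d. poly (\<Phi> n A) (real j) * coeff (lagrange d j) i)" for n
      using arg_cong[OF interp[OF A, of n], of "\<lambda>p. coeff p i"] by (simp add: coeff_sum)
    ultimately show ?thesis unfolding \<Psi>_def by (simp add: coeff_sum)
  qed
  show ?thesis
  proof (rule exI[of _ \<Psi>], intro conjI allI impI; elim conjE)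
    fix A :: "'a set" assume A: "compact A" "convex A"
    show "degree (\<Psi> A) \<le> DIM('a)" unfolding \<Psi>_def d_def
      by (rule degree_sum_le) (auto intro: degree_smult_le[THEN order_trans] degree_lagrange)
    fix t :: real assume t: "0 \<le> t"
    have "(\<lambda>n. \<Sum>j\<le>d. poly (\<Phi> n A) (real j) * poly (lagrange d j) t) \<longlonglongrightarrow> (\<Sum>j\<le>d. V A (real j) * poly (lagrange d j) t)"
      by (intro tendsto_intros lim A) simp
    moreover have "poly (\<Phi> n A) t = (\<Sum>j\<le>d. poly (\<Phi> n A) (real j) * poly (lagrange d j) t)" for n
      using arg_cong[OF interp[OF A, of n], of "\<lambda>p. poly p t"] by (simp add: poly_sum)
    ultimately have "(\<lambda>n. poly (\<Phi> n A) t) \<longlonglongrightarrow> poly (\<Psi> A) t" unfolding \<Psi>_def by (simp add: poly_sum)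
    then show "vol (minkowski_sum A (cball 0 t)) = poly (\<Psi> A) t"
      using lim[OF A t] LIMSEQ_unique unfolding V_def by blast
  next
    fix A A' :: "'a set" and i
    assume A: "compact A" "convex A" "compact A'" "convex A'" "A \<subseteq> A'"
    show "coeff (\<Psi> A) i \<le> coeff (\<Psi> A') i"
      by (rule LIMSEQ_le[OF coeffs coeffs]) (use A M in auto)
  qed
qed

section \<open>Steiner coefficients of segments and parallelograms\<close>

lemma poly_eq_sum_coeff:
  fixes p :: "real poly"
  assumes "degree p \<le> n"
  shows "poly p t = (\<Sum>i\<le>n. coeff p i * t ^ i)"
  unfolding poly_altdef using assms
  by (intro sum.mono_neutral_left) (auto simp: coeff_eq_0 not_le)

text \<open>The binomial factors stay inside the coefficients: \<open>coeff p i\<close> is (d choose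
  i) W_i. A relation avoids choosing a polynomial for sets that have none.\<close>

definition steiner :: "'a::euclidean_space set \<Rightarrow> real poly \<Rightarrow> bool" where
  "steiner A p \<longleftrightarrow> degree p \<le> DIM('a) \<and>
     (\<forall>t\<ge>0. vol (minkowski_sum A (cball 0 t)) = poly p t)"

lemma steiner_exists: "compact A \<Longrightarrow> convex A \<Longrightarrow> \<exists>p. steiner A p"
  using steiner_polynomial[where 'a='a] unfolding steiner_def by (elim exE conjE) blast

lemma steiner_unique: "steiner A p \<Longrightarrow> steiner A q \<Longrightarrow> p = q"
  unfolding steiner_def by (auto intro: poly_eqI_nonneg)

lemma steiner_coeff_mono:
  fixes A A' :: "'a::euclidean_space set"
  assumes "compact A" "convex A" "compact A'" "convex A'" "A \<subseteq> A'" "steiner A p" "steiner A' p'"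
  shows "coeff p i \<le> coeff p' i"
proof -
  obtain \<Psi> :: "'a set \<Rightarrow> real poly" where
    1: "\<forall>A. compact A \<and> convex A \<longrightarrow> degree (\<Psi> A) \<le> DIM('a) \<and>
        (\<forall>t\<ge>0. vol (minkowski_sum A (cball 0 t)) = poly (\<Psi> A) t)" and
    2: "\<forall>A A' i. compact A \<and> convex A \<and> compact A' \<and> convex A' \<and> A \<subseteq> A' \<longrightarrow>
        coeff (\<Psi> A) i \<le> coeff (\<Psi> A') i"
    using steiner_polynomial by (elim exE conjE)
  have "steiner A (\<Psi> A)" "steiner A' (\<Psi> A')" using 1 assms unfolding steiner_def by auto
  then have "p = \<Psi> A" "p' = \<Psi> A'" using assms steiner_unique by auto
  then show ?thesis using 2 assms by simp
qed

lemma steiner_coeff_nonneg: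
  assumes "compact A" "convex A" "steiner A p"
  shows "0 \<le> coeff p i"
  using steiner_coeff_mono[of "{}" A 0 p i] assms by (simp add: steiner_def)

lemma steiner_translation: "steiner A p \<Longrightarrow> steiner ((+) a ` A) p"
  unfolding steiner_def minkowski_sum_translation vol_translation .

text \<open>As a polynomial in \<open>s\<close> this is \<open>vol (s A + B)\<close>, whose growth detects the dimension of \<open>A\<close>.\<close>

definition reversed_steiner :: "nat \<Rightarrow> real poly \<Rightarrow> real poly" where
  "reversed_steiner d p = (\<Sum>m\<le>d. monom (coeff p m) (d - m))"

lemma coeff_reversed_steiner: "m \<le> d \<Longrightarrow> coeff (reversed_steiner d p) m = coeff p (d - m)"
proof -
  assume m: "m \<le> d"
  have "coeff (reversed_steiner d p) m = (\<Sum>k\<le>d. if k = d - m then coeff p (d - m) else 0)"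
    unfolding reversed_steiner_def coeff_sum by (rule sum.cong) (use m in auto)
  then show ?thesis by simp
qed

lemma coeff_reversed_steiner_gt: "d < m \<Longrightarrow> coeff (reversed_steiner d p) m = 0"
  unfolding reversed_steiner_def coeff_sum by (intro sum.neutral) auto

text \<open>Rests on s A + B = s (A + (1/s) B): the factor s^d from the scaled volume reverses the
  order of the coefficients.\<close>

lemma poly_reversed_steiner:
  fixes A :: "'a::euclidean_space set"
  assumes "steiner A p" "0 < s"
  shows "vol (minkowski_sum ((*\<^sub>R) s ` A) (cball 0 1)) = poly (reversed_steiner DIM('a) p) s"
proof -
  have "(*\<^sub>R) s ` cball (0::'a) (1 / s) = cball 0 1"
    using assms cball_scale[of s "0::'a" "1/s"] by simp
  then have "vol (minkowski_sum ((*\<^sub>R) s ` A) (cball 0 1)) = vol ((*\<^sub>R) s ` minkowski_sum A (cball 0 (1 / s)))"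
    by (simp add: minkowski_sum_scaleR)
  also have "\<dots> = s ^ DIM('a) * poly p (1 / s)"
    using assms unfolding steiner_def vol_scaleR by simp
  also have "\<dots> = s ^ DIM('a) * (\<Sum>m\<le>DIM('a). coeff p m * (1 / s) ^ m)"
    using assms poly_eq_sum_coeff[of p "DIM('a)"] unfolding steiner_def by simp
  also have "\<dots> = (\<Sum>m\<le>DIM('a). coeff p m * s ^ (DIM('a) - m))"
    unfolding sum_distrib_left
    by (rule sum.cong) (use assms in \<open>auto simp: power_diff power_one_over field_simps\<close>)
  also have "\<dots> = poly (reversed_steiner DIM('a) p) s"
    unfolding reversed_steiner_def poly_sum by (simp add: poly_monom)
  finally show ?thesis .
qed

lemma reversed_steiner_nonneg:
  fixes A :: "'a::euclidean_space set"
  assumes "compact A" "convex A" "steiner A p"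
  shows "0 \<le> coeff (reversed_steiner DIM('a) p) m"
  using assms steiner_coeff_nonneg coeff_reversed_steiner coeff_reversed_steiner_gt
  by (metis le_less_linear order_refl)

text \<open>The volume is affine in s with nonnegative value at 0, hence at most proportional to s
  from s = 1 on. Each segment thus contributes one power of s to the growth.\<close>

lemma vol_add_long_segment_le:
  assumes "compact A" "convex A" "1 \<le> s"
  shows "vol (minkowski_sum A (closed_segment 0 (s *\<^sub>R u))) \<le> s * vol (minkowski_sum A (closed_segment 0 u))"
proof -
  have "vol A \<le> s * vol A" using assms(3) by (simp add: mult_le_cancel_right1)
  then show ?thesis using vol_add_segment_affine[OF assms(1,2), of s u] assms(3) by (simp add: algebra_simps)
qed

lemma scaleR_closed_segment_0: "(*\<^sub>R) s ` closed_segment 0 u = closed_segment 0 (s *\<^sub>R u)"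
  using closed_segment_linear_image[of "(*\<^sub>R) s" 0 u] by (simp add: linear_scale_self)

text \<open>The volume of s A + B grows at most linearly in s, so the reversed polynomial has no
  coefficient of index d - m \<ge> 2.\<close>

lemma steiner_segment_coeff_0:
  fixes a b :: "'a::euclidean_space"
  assumes p: "steiner (closed_segment a b) p" and m: "m + 2 \<le> DIM('a)"
  shows "coeff p m = 0"
proof -
  define A where "A = closed_segment 0 (b - a)"
  have "A = (+) (- a) ` closed_segment a b"
    unfolding A_def using closed_segment_translation[of "-a" a b] by simp
  then have pA: "steiner A p" using steiner_translation[OF p, of "- a"] by argo
  have cA: "compact A" "convex A" unfolding A_def by auto
  define q where "q = reversed_steiner DIM('a) p"
  have "coeff q (DIM('a) - m) = 0"
  proof (rule nonneg_coeff_eq_0_of_growth[where d = 1])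
    show "0 \<le> coeff q i" for i unfolding q_def by (rule reversed_steiner_nonneg[OF cA pA])
    fix t :: real assume t: "1 \<le> t"
    have "poly q t = vol (minkowski_sum (cball 0 1) (closed_segment 0 (t *\<^sub>R (b - a))))"
      unfolding q_def using poly_reversed_steiner[OF pA, of t] t
      by (simp add: A_def scaleR_closed_segment_0 minkowski_sum_commute)
    also have "\<dots> \<le> t * vol (minkowski_sum (cball 0 1) (closed_segment 0 (b - a)))"
      by (rule vol_add_long_segment_le) (use t in auto)
    finally show "poly q t \<le> vol (minkowski_sum (cball 0 1) (closed_segment 0 (b - a))) * t ^ 1"
      by (simp add: mult.commute)
  qed (use m in auto)
  then show ?thesis unfolding q_def using coeff_reversed_steiner[of "DIM('a) - m" "DIM('a)" p] m by simp
qed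

text \<open>With w the part of v orthogonal to u, a lattice vector has norm at least |b| |w|, and
  exactly |a| |u| if b = 0; integrality makes the relevant factor at least 1.\<close>

lemma lattice_separation:
  fixes u v :: "'a::euclidean_space"
  assumes u: "u \<noteq> 0" and v: "\<And>c. v \<noteq> c *\<^sub>R u"
  shows "\<exists>\<delta>>0. \<forall>a b::int. (a, b) \<noteq> (0, 0) \<longrightarrow> \<delta> \<le> norm (of_int a *\<^sub>R u + of_int b *\<^sub>R v)"
proof -
  define \<alpha> where "\<alpha> = (u \<bullet> v) / (u \<bullet> u)"
  define w where "w = v - \<alpha> *\<^sub>R u"
  have w: "w \<noteq> 0" "u \<bullet> w = 0" using u v[of \<alpha>] unfolding w_def \<alpha>_def by (auto simp: inner_diff_right)
  have eq: "(norm (a *\<^sub>R u + b *\<^sub>R v))\<^sup>2 = ((a + b * \<alpha>) * norm u)\<^sup>2 + (b * norm w)\<^sup>2" for a b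
  proof -
    have "a *\<^sub>R u + b *\<^sub>R v = (a + b * \<alpha>) *\<^sub>R u + b *\<^sub>R w" unfolding w_def by (simp add: algebra_simps)
    moreover have "orthogonal ((a + b * \<alpha>) *\<^sub>R u) (b *\<^sub>R w)" using w unfolding orthogonal_def by simp
    ultimately show ?thesis using norm_add_Pythagorean[of "(a + b * \<alpha>) *\<^sub>R u" "b *\<^sub>R w"]
      by (simp add: power_mult_distrib)
  qed
  have "min (norm u) (norm w) \<le> norm (of_int a *\<^sub>R u + of_int b *\<^sub>R v)" if ab: "(a, b) \<noteq> (0, 0)" for a b :: int
  proof (cases "b = 0")
    case True
    then have "1 \<le> \<bar>real_of_int a\<bar>" using ab by simp
    then have "norm u \<le> \<bar>of_int a\<bar> * norm u" by (simp add: mult_le_cancel_right1)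
    then show ?thesis using True by simp
  next
    case False
    then have "1 \<le> \<bar>real_of_int b\<bar>" by simp
    then have "norm w \<le> \<bar>of_int b\<bar> * norm w" by (simp add: mult_le_cancel_right1)
    then have "(norm w)\<^sup>2 \<le> (of_int b * norm w)\<^sup>2"
      by (metis abs_mult abs_norm_cancel abs_le_square_iff)
    also have "\<dots> \<le> (norm (of_int a *\<^sub>R u + of_int b *\<^sub>R v))\<^sup>2" unfolding eq by simp
    finally have "norm w \<le> norm (of_int a *\<^sub>R u + of_int b *\<^sub>R v)" by (rule power2_le_imp_le) simp
    then show ?thesis by simp
  qed
  then show ?thesis using u w by (intro exI[of _ "min (norm u) (norm w)"]) auto
qed

text \<open>The n-fold parallelogram contains n^2 lattice points, and equal disjoint balls around
  them fit into its unit neighbourhood.\<close>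

lemma vol_long_parallelogram_ge:
  fixes u v :: "'a::euclidean_space"
  assumes u: "u \<noteq> 0" and v: "\<And>c. v \<noteq> c *\<^sub>R u"
  shows "\<exists>\<kappa>>0. \<forall>n\<ge>1. \<kappa> * real n ^ 2 \<le> vol (minkowski_sum ((*\<^sub>R) (real n) `
           minkowski_sum (closed_segment 0 u) (closed_segment 0 v)) (cball 0 1))"
proof -
  obtain \<delta> where \<delta>: "\<delta> > 0"
    "\<And>a b::int. (a, b) \<noteq> (0, 0) \<Longrightarrow> \<delta> \<le> norm (of_int a *\<^sub>R u + of_int b *\<^sub>R v)"
    using lattice_separation[OF u v] by blast
  \<comment> \<open>At most 1 so that the balls stay in the unit neighbourhood; a third of \<delta>,
    rather than half, so that closed balls are disjoint.\<close>
  define \<rho> where "\<rho> = min 1 (\<delta> / 3)"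
  have \<rho>: "0 < \<rho>" "\<rho> \<le> 1" "2 * \<rho> < \<delta>" using \<delta>(1) unfolding \<rho>_def by auto
  define c where "c ij = real (fst ij) *\<^sub>R u + real (snd ij) *\<^sub>R v" for ij :: "nat \<times> nat"
  have disj: "cball (c i) \<rho> \<inter> cball (c j) \<rho> = {}" if "i \<noteq> j" for i j
  proof (rule ccontr)
    assume "cball (c i) \<rho> \<inter> cball (c j) \<rho> \<noteq> {}"
    then obtain x where "dist (c i) x \<le> \<rho>" "dist (c j) x \<le> \<rho>" by auto
    then have "dist (c i) (c j) \<le> 2 * \<rho>" using dist_triangle2[of "c i" "c j" x] by linarith
    moreover have "(int (fst i) - int (fst j), int (snd i) - int (snd j)) \<noteq> (0, 0)"
      using that by (auto simp: prod_eq_iff)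
    from \<delta>(2)[OF this] have "\<delta> \<le> dist (c i) (c j)"
      unfolding c_def dist_norm by (simp add: algebra_simps)
    ultimately show False using \<rho> by linarith
  qed
  define \<kappa> where "\<kappa> = vol (cball (0::'a) \<rho>)"
  have "\<kappa> > 0" unfolding \<kappa>_def using \<rho> by (simp add: content_cball)
  moreover have "\<kappa> * real n ^ 2 \<le> vol (minkowski_sum ((*\<^sub>R) (real n) `
           minkowski_sum (closed_segment 0 u) (closed_segment 0 v)) (cball 0 1))" (is "_ \<le> vol ?X") if n: "1 \<le> n" for n
  proof -
    let ?I = "{..<n} \<times> {..<n}"
    have X: "compact ?X"
      by (intro compact_minkowski_sum compact_scaling compact_segment compact_cball)
    have "cball (c i) \<rho> \<subseteq> ?X" if i: "i \<in> ?I" for i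
    proof
      fix x assume x: "x \<in> cball (c i) \<rho>"
      have "c i \<in> minkowski_sum (closed_segment 0 (real n *\<^sub>R u)) (closed_segment 0 (real n *\<^sub>R v))"
        using i unfolding c_def minkowski_sum_def closed_segment_0_scaleR[OF of_nat_0_le_iff] by force
      moreover have "x - c i \<in> cball 0 1" using x \<rho>(2) by (auto simp: dist_norm norm_minus_commute)
      ultimately have "c i + (x - c i) \<in> minkowski_sum (minkowski_sum (closed_segment 0 (real n *\<^sub>R u)) (closed_segment 0 (real n *\<^sub>R v))) (cball 0 1)"
        unfolding minkowski_sum_def[of _ "cball 0 1"] by blast
      then show "x \<in> ?X" by (simp add: minkowski_sum_scaleR scaleR_closed_segment_0)
    qed
    then have "vol (\<Union>i\<in>?I. cball (c i) \<rho>) \<le> vol ?X"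
      by (intro vol_mono X compact_UN) auto
    moreover have "vol (\<Union>i\<in>?I. cball (c i) \<rho>) = (\<Sum>i\<in>?I. vol (cball (c i) \<rho>))"
      by (rule measure_UNION') (auto simp: pairwise_def disjnt_def disj)
    moreover have "(\<Sum>i\<in>?I. vol (cball (c i) \<rho>)) = \<kappa> * real n ^ 2"
      unfolding \<kappa>_def using \<rho> by (simp add: content_cball power2_eq_square)
    ultimately show ?thesis by simp
  qed
  ultimately show ?thesis by blast
qed

text \<open>The volume of s A + B grows at most quadratically, by two applications of the segment
  bound, and at least quadratically, by the lattice points. So the reversed polynomial has a nonzero
  coefficient at 2.\<close>

lemma steiner_parallelogram_coeff_pos:
  fixes u v :: "'a::euclidean_space"
  assumes u: "u \<noteq> 0" and v: "\<And>c. v \<noteq> c *\<^sub>R u" and d: "2 \<le> DIM('a)"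
    and p: "steiner (minkowski_sum (closed_segment 0 u) (closed_segment 0 v)) p"
  shows "0 < coeff p (DIM('a) - 2)"
proof -
  define A where "A = minkowski_sum (closed_segment 0 u) (closed_segment 0 v)"
  have cA: "compact A" "convex A" unfolding A_def by (auto intro: compact_minkowski_sum convex_minkowski_sum)
  have pA: "steiner A p" using p unfolding A_def .
  define q where "q = reversed_steiner DIM('a) p"
  have qn: "0 \<le> coeff q i" for i unfolding q_def by (rule reversed_steiner_nonneg[OF cA pA])
  have upper: "coeff q m = 0" if "2 < m" for m
  proof (rule nonneg_coeff_eq_0_of_growth[OF qn _ that])
    fix t :: real assume t: "1 \<le> t"
    let ?U = "\<lambda>t. closed_segment 0 (t *\<^sub>R u)" and ?V = "\<lambda>t. closed_segment 0 (t *\<^sub>R v)" and ?B = "cball (0::'a) 1"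
    have "poly q t = vol (minkowski_sum (minkowski_sum ?B (?U t)) (?V t))"
      unfolding q_def using poly_reversed_steiner[OF pA, of t] t
      by (simp add: A_def minkowski_sum_scaleR scaleR_closed_segment_0 minkowski_sum_commute[of _ "cball 0 1"] minkowski_sum_assoc)
    also have "\<dots> \<le> t * vol (minkowski_sum (minkowski_sum ?B (?U t)) (?V 1))"
      unfolding scaleR_one by (rule vol_add_long_segment_le) (use t in \<open>auto intro: compact_minkowski_sum convex_minkowski_sum\<close>)
    also have "minkowski_sum (minkowski_sum ?B (?U t)) (?V 1) = minkowski_sum (minkowski_sum ?B (?V 1)) (?U t)"
      by (metis minkowski_sum_assoc minkowski_sum_commute)
    also have "t * vol (minkowski_sum (minkowski_sum ?B (?V 1)) (?U t)) \<le> t * (t * vol (minkowski_sum (minkowski_sum ?B (?V 1)) (?U 1)))"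
      unfolding scaleR_one by (intro mult_left_mono vol_add_long_segment_le)
        (use t in \<open>auto intro: compact_minkowski_sum convex_minkowski_sum\<close>)
    finally show "poly q t \<le> vol (minkowski_sum (minkowski_sum ?B (?V 1)) (?U 1)) * t ^ 2"
      by (simp add: power2_eq_square mult_ac)
  qed
  have "coeff q 2 \<noteq> 0"
  proof
    assume 2: "coeff q 2 = 0"
    have "degree q \<le> 1"
      by (rule degree_le) (use upper 2 in \<open>metis One_nat_def Suc_lessI numeral_2_eq_2\<close>)
    then have qt: "poly q t = coeff q 0 + coeff q 1 * t" for t
      using poly_eq_sum_coeff[of q 1 t] by simp
    obtain \<kappa> where \<kappa>: "\<kappa> > 0" "\<And>n. n \<ge> 1 \<Longrightarrow> \<kappa> * real n ^ 2 \<le> vol (minkowski_sum ((*\<^sub>R) (real n) ` A) (cball 0 1))"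
      using vol_long_parallelogram_ge[OF u v] unfolding A_def by blast
    \<comment> \<open>Makes \<kappa> n exceed q_0 + q_1, against the bound q(n) \<le> (q_0 + q_1) n
      for a polynomial of degree at most 1.\<close>
    define n where "n = Suc (nat \<lceil>(coeff q 0 + coeff q 1) / \<kappa>\<rceil>)"
    have n: "n \<ge> 1" "real n > (coeff q 0 + coeff q 1) / \<kappa>" unfolding n_def by linarith+
    have "\<kappa> * real n ^ 2 \<le> coeff q 0 + coeff q 1 * real n"
      using \<kappa>(2)[OF n(1)] poly_reversed_steiner[OF pA, of "real n"] n qt unfolding q_def by simp
    also have "\<dots> \<le> (coeff q 0 + coeff q 1) * real n"
      using mult_right_mono[of 1 "real n" "coeff q 0"] qn[of 0] n(1) by (simp add: algebra_simps)
    finally have "\<kappa> * real n \<le> coeff q 0 + coeff q 1"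
      using n(1) by (simp add: power2_eq_square mult.assoc[symmetric])
    then show False using n(2) \<kappa>(1) by (simp add: field_simps)
  qed
  then show ?thesis using qn[of 2] coeff_reversed_steiner[OF d, of p] unfolding q_def by simp
qed

text \<open>Three non-collinear points of \<open>L\<close> span a triangle that contains a
  parallelogram, and coefficients are monotone under inclusion.\<close>

lemma steiner_coeff_pos_of_not_collinear:
  fixes L :: "'a::euclidean_space set"
  assumes L: "compact L" "convex L" "\<not> collinear L" and d: "2 \<le> DIM('a)" and p: "steiner L p"
  shows "0 < coeff p (DIM('a) - 2)"
proof -
  obtain x where x: "x \<in> L" using L(3) by (metis all_not_in_conv collinear_empty)
  obtain y where y: "y \<in> L" "y \<noteq> x" using L(3) x by (metis collinear_sing subsetI insertCI singletonD subset_singletonD empty_iff insertI1)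
  have "\<exists>z\<in>L. \<forall>c. z - x \<noteq> c *\<^sub>R (y - x)"
  proof (rule ccontr)
    assume "\<not> ?thesis"
    then obtain c where c: "\<And>z. z \<in> L \<Longrightarrow> z - x = c z *\<^sub>R (y - x)" by metis
    have "z - z' = (c z - c z') *\<^sub>R (y - x)" if "z \<in> L" "z' \<in> L" for z z'
      using c[OF that(1)] c[OF that(2)]
      by (metis diff_diff_eq2 diff_add_cancel scaleR_diff_left add_diff_cancel_right)
    then show False using L(3) unfolding collinear_def by blast
  qed
  then obtain z where z: "z \<in> L" "\<And>c. z - x \<noteq> c *\<^sub>R (y - x)" by blast
  \<comment> \<open>Halving the edges keeps the parallelogram at x inside the triangle: the
    barycentric coordinates are 1 - a/2 - b/2, a/2 and b/2.\<close>
  define u where "u = (1/2) *\<^sub>R (y - x)"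
  define v where "v = (1/2) *\<^sub>R (z - x)"
  define A where "A = minkowski_sum (closed_segment 0 u) (closed_segment 0 v)"
  have cA: "compact A" "convex A" unfolding A_def by (auto intro: compact_minkowski_sum convex_minkowski_sum)
  obtain q where q: "steiner A q" using steiner_exists[OF cA] by blast
  have "u \<noteq> 0" using y unfolding u_def by simp
  moreover have "v \<noteq> c *\<^sub>R u" for c
  proof
    assume "v = c *\<^sub>R u"
    then have "(1/2) *\<^sub>R (z - x) = (1/2) *\<^sub>R (c *\<^sub>R (y - x))" unfolding u_def v_def by simp
    then have "z - x = c *\<^sub>R (y - x)" by (rule scaleR_left_imp_eq[rotated]) simp
    then show False using z by blast
  qed
  ultimately have "0 < coeff q (DIM('a) - 2)"
    using steiner_parallelogram_coeff_pos d q unfolding A_def by blast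
  also have "\<dots> \<le> coeff p (DIM('a) - 2)"
  proof (rule steiner_coeff_mono[OF _ _ L(1,2) _ steiner_translation[OF q, of x] p])
    show "(+) x ` A \<subseteq> L"
    proof
      fix w assume "w \<in> (+) x ` A"
      then obtain a b where ab: "0 \<le> a" "a \<le> 1" "0 \<le> b" "b \<le> 1" "w = x + (a *\<^sub>R u + b *\<^sub>R v)"
        unfolding A_def minkowski_sum_def closed_segment_def by auto
      have "w = (1 - a/2 - b/2) *\<^sub>R x + (a/2) *\<^sub>R y + (b/2) *\<^sub>R z"
        unfolding ab(5) u_def v_def by (simp add: algebra_simps)
      also have "\<dots> \<in> convex hull {x, y, z}"
        unfolding convex_hull_3 mem_Collect_eq by (intro exI conjI, rule refl) (use ab in auto)
      also have "\<dots> \<subseteq> L" using L(2) x y z by (intro hull_minimal) auto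
      finally show "w \<in> L" .
    qed
  qed (use cA in \<open>auto intro: compact_translation convex_translation\<close>)
  finally show ?thesis .
qed

section \<open>Support functions and inner balls\<close>

text \<open>At the first point where \<open>\<phi>\<close> minus its chord is maximal, a local affine minorant must be
  constant, so the maximum is also attained to the left.\<close>

lemma local_affine_minorant_imp_below_chord:
  fixes \<phi> :: "real \<Rightarrow> real"
  assumes cont: "continuous_on {0..1} \<phi>"
    and supp: "\<And>s. 0 < s \<Longrightarrow> s < 1 \<Longrightarrow>
        \<exists>a e. e > 0 \<and> (\<forall>t\<in>{0..1}. \<bar>t - s\<bar> < e \<longrightarrow> \<phi> s + a * (t - s) \<le> \<phi> t)"
    and s: "0 \<le> s" "s \<le> 1"
  shows "\<phi> s \<le> (1 - s) * \<phi> 0 + s * \<phi> 1"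
proof (rule ccontr)
  assume neg: "\<not> ?thesis"
  define \<psi> where "\<psi> t = \<phi> t - ((1 - t) * \<phi> 0 + t * \<phi> 1)" for t
  have c\<psi>: "continuous_on {0..1} \<psi>" unfolding \<psi>_def by (intro continuous_intros cont)
  obtain m where m: "m \<in> {0..1}" "\<And>t. t \<in> {0..1} \<Longrightarrow> \<psi> t \<le> \<psi> m"
    using continuous_attains_sup[OF _ _ c\<psi>] by (metis atLeastAtMost_iff atLeastatMost_empty_iff compact_Icc zero_le_one linorder_not_le)
  have pos: "0 < \<psi> m" using m(2)[of s] neg s unfolding \<psi>_def by force
  define T where "T = {t\<in>{0..1}. \<psi> t = \<psi> m}"
  have "closed T" unfolding T_def
    using continuous_closed_preimage_constant[OF c\<psi>, of "\<psi> m"] by simp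
  then have "compact T" unfolding T_def by (metis (no_types, lifting) bounded_closed_interval bounded_subset compact_eq_bounded_closed mem_Collect_eq subsetI)
  moreover have "T \<noteq> {}" using m unfolding T_def by auto
  ultimately obtain z where z: "z \<in> T" "\<And>t. t \<in> T \<Longrightarrow> z \<le> t"
    using compact_attains_inf[of T] by blast
  have z01: "0 < z" "z < 1"
    using z(1) pos unfolding T_def \<psi>_def by (auto simp: less_le)
  obtain a e where ae: "e > 0" "\<And>t. t \<in> {0..1} \<Longrightarrow> \<bar>t - z\<bar> < e \<Longrightarrow> \<phi> z + a * (t - z) \<le> \<phi> t"
    using supp[OF z01] by blast
  define b where "b = a - (\<phi> 1 - \<phi> 0)"
  have loc: "\<psi> m + b * (t - z) \<le> \<psi> t" if "t \<in> {0..1}" "\<bar>t - z\<bar> < e" for t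
  proof -
    have "\<psi> m = \<psi> z" using z(1) unfolding T_def by simp
    then show ?thesis using ae(2)[OF that] unfolding \<psi>_def b_def by (simp add: algebra_simps)
  qed
  \<comment> \<open>Keeps z - h and z + h in the unit interval and in the neighbourhood of z.
    Maximality tested on both sides then forces the slope \<open>b\<close> to be 0.\<close>
  define h where "h = Min {e / 2, z, 1 - z}"
  have h: "h > 0" "h \<le> e/2" "h \<le> z" "h \<le> 1 - z" using z01 ae(1) unfolding h_def by (auto simp: min_def)
  have "b * h \<le> 0" using loc[of "z + h"] m(2)[of "z + h"] h z01 ae(1) by simp
  moreover have "b * (- h) \<le> 0" using loc[of "z - h"] m(2)[of "z - h"] h z01 ae(1) by simp
  ultimately have "b * h = 0" by simp
  then have "b = 0" using h(1) by simp
  then have "\<psi> (z - h) = \<psi> m" using loc[of "z - h"] m(2)[of "z - h"] h z01 ae(1) by simp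
  then have "z - h \<in> T" unfolding T_def using h z01 by simp
  then show False using z(2)[of "z - h"] h by simp
qed

definition support_fun :: "'a::euclidean_space set \<Rightarrow> 'a \<Rightarrow> real" where
  "support_fun K u = (SUP x\<in>K. x \<bullet> u)"

context
  fixes K :: "'a::euclidean_space set"
  assumes comp: "compact K" and ne: "K \<noteq> {}"
begin

lemma support_fun_attained: "\<exists>x\<in>K. x \<bullet> u = support_fun K u \<and> (\<forall>y\<in>K. y \<bullet> u \<le> x \<bullet> u)"
proof -
  have "continuous_on K (\<lambda>x. x \<bullet> u)" by (intro continuous_intros)
  then obtain x where x: "x \<in> K" "\<forall>y\<in>K. y \<bullet> u \<le> x \<bullet> u"
    using continuous_attains_sup[OF comp ne] by blast
  then have "support_fun K u = x \<bullet> u"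
    unfolding support_fun_def by (intro cSup_eq_maximum) auto
  then show ?thesis using x by auto
qed

lemma support_fun_ge: "x \<in> K \<Longrightarrow> x \<bullet> u \<le> support_fun K u"
  using support_fun_attained[of u] by force

lemma continuous_support_fun: "continuous_on S (support_fun K)"
proof -
  have "convex_on UNIV (support_fun K)"
  proof (rule convex_onI)
    fix t :: real and x y assume t: "0 < t" "t < 1"
    obtain z where z: "z \<in> K" "z \<bullet> ((1 - t) *\<^sub>R x + t *\<^sub>R y) = support_fun K ((1 - t) *\<^sub>R x + t *\<^sub>R y)"
      using support_fun_attained by blast
    have "(1 - t) * (z \<bullet> x) \<le> (1 - t) * support_fun K x" "t * (z \<bullet> y) \<le> t * support_fun K y"
      using t support_fun_ge[OF z(1)] by (auto intro!: mult_left_mono)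
    then show "support_fun K ((1 - t) *\<^sub>R x + t *\<^sub>R y) \<le> (1 - t) * support_fun K x + t * support_fun K y"
      unfolding z(2)[symmetric] by (simp add: inner_add_right)
  qed simp
  then have "continuous_on UNIV (support_fun K)" by (rule convex_on_continuous[OF open_UNIV])
  then show ?thesis using continuous_on_subset by blast
qed

lemma mem_of_inner_le_support_fun:
  assumes "convex K" "\<And>u. y \<bullet> u \<le> support_fun K u"
  shows "y \<in> K"
proof (rule ccontr)
  assume "y \<notin> K"
  then obtain w \<beta> where w: "w \<bullet> y < \<beta>" "\<And>z. z \<in> K \<Longrightarrow> \<beta> < w \<bullet> z"
    using separating_hyperplane_closed_point[of K y] assms comp compact_imp_closed by blast
  obtain z where z: "z \<in> K" "z \<bullet> (- w) = support_fun K (- w)" using support_fun_attained by blast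
  have "y \<bullet> (- w) \<le> z \<bullet> (- w)" using assms(2)[of "- w"] z by simp
  then show False using w(1) w(2)[OF z(1)] by (simp add: inner_commute)
qed

lemma support_fun_scaleR: "0 \<le> t \<Longrightarrow> support_fun K (t *\<^sub>R u) = t * support_fun K u"
proof -
  assume t: "0 \<le> t"
  obtain z where z: "z \<in> K" "z \<bullet> (t *\<^sub>R u) = support_fun K (t *\<^sub>R u)" using support_fun_attained by blast
  obtain y where y: "y \<in> K" "y \<bullet> u = support_fun K u" using support_fun_attained by blast
  have "support_fun K (t *\<^sub>R u) \<le> t * support_fun K u"
    using z support_fun_ge[OF z(1), of u] t by (metis inner_scaleR_right mult_left_mono)
  moreover have "t * support_fun K u \<le> support_fun K (t *\<^sub>R u)"
    using y support_fun_ge[OF y(1), of "t *\<^sub>R u"] by simp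
  ultimately show ?thesis by simp
qed

end

section \<open>From local inner balls to global ones\<close>

lemma maximizer_in_frontier:
  fixes K :: "'a::euclidean_space set"
  assumes "p \<in> K" "\<And>y. y \<in> K \<Longrightarrow> y \<bullet> \<nu> \<le> p \<bullet> \<nu>" "\<nu> \<noteq> 0"
  shows "p \<in> frontier K"
proof -
  have "p \<notin> interior K"
  proof
    assume "p \<in> interior K"
    then obtain e where e: "e > 0" "cball p e \<subseteq> K" by (meson mem_interior_cball)
    have "p + (e / norm \<nu>) *\<^sub>R \<nu> \<in> K" using e assms(3) by (intro subsetD[OF e(2)]) (simp add: dist_norm)
    have "\<nu> \<bullet> \<nu> > 0" using assms(3) by simp
    with assms(2)[OF \<open>p + (e / norm \<nu>) *\<^sub>R \<nu> \<in> K\<close>] show False using e assms(3) by (simp add: inner_add_left mult_le_0_iff divide_le_0_iff not_le[symmetric])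
  qed
  then show ?thesis using assms(1) closure_subset unfolding frontier_def by auto
qed

text \<open>The inner ball at a point \<open>p\<close> of \<open>K\<close> extremal in direction
  \<nu> must touch the supporting hyperplane there, so its centre is p - \<nu> / \<lambda>. For
  nearby u its extreme point stays in \<open>K\<close> and bounds the support function below by that
  of the ball.\<close>

lemma local_inner_ball:
  fixes K :: "'a::euclidean_space set"
  assumes comp: "compact K" and ne: "K \<noteq> {}" and conc: "lambda_concave lam K" and lam: "lam > 0"
    and \<nu>: "norm \<nu> = 1"
  shows "\<exists>c. c \<bullet> \<nu> + 1 / lam = support_fun K \<nu> \<and>
     (\<exists>e>0. \<forall>u. dist u \<nu> < e \<longrightarrow> c \<bullet> u + norm u / lam \<le> support_fun K u)"
proof -
  define r where "r = 1 / lam"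
  have r: "r > 0" unfolding r_def using lam by simp
  obtain p where p: "p \<in> K" "p \<bullet> \<nu> = support_fun K \<nu>" "\<And>y. y \<in> K \<Longrightarrow> y \<bullet> \<nu> \<le> p \<bullet> \<nu>"
    using support_fun_attained[OF comp ne, of \<nu>] by blast
  have "\<nu> \<noteq> 0" using \<nu> by auto
  then have "p \<in> frontier K" using maximizer_in_frontier p(1,3) by blast
  then obtain c U where cU: "dist c p = r" "open U" "p \<in> U" "cball c r \<inter> U \<subseteq> K \<inter> U"
    using conc unfolding lambda_concave_def r_def by blast
  \<comment> \<open>Only the part of the ball in \<open>U\<close> is known to lie in
    \<open>K\<close>; sliding y towards p enters \<open>U\<close>, and the sign of (y - p) . \<nu>
    does not change on the way.\<close>
  have half: "y \<bullet> \<nu> \<le> p \<bullet> \<nu>" if y: "y \<in> cball c r" for y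
  proof -
    have "((\<lambda>t. p + t *\<^sub>R (y - p)) \<longlongrightarrow> p + 0 *\<^sub>R (y - p)) (at_right (0::real))"
      by (intro tendsto_intros)
    then have "eventually (\<lambda>t. p + t *\<^sub>R (y - p) \<in> U) (at_right (0::real))"
      using cU(2,3) by (intro topological_tendstoD) auto
    moreover have "eventually (\<lambda>t::real. t \<in> {0<..<1}) (at_right 0)"
      by (rule eventually_at_right_real) simp
    ultimately have "eventually (\<lambda>t. p + t *\<^sub>R (y - p) \<in> U \<and> t \<in> {0<..<1}) (at_right (0::real))"
      by (rule eventually_conj)
    then have "\<exists>t::real. p + t *\<^sub>R (y - p) \<in> U \<and> t \<in> {0<..<1}"
      by (rule eventually_happens'[OF trivial_limit_at_right_real])
    then obtain t :: real where t: "0 < t" "t < 1" "p + t *\<^sub>R (y - p) \<in> U" by auto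
    have "(1 - t) *\<^sub>R p + t *\<^sub>R y \<in> cball c r"
      using t y cU(1) by (intro convexD[OF convex_cball]) auto
    moreover have "(1 - t) *\<^sub>R p + t *\<^sub>R y = p + t *\<^sub>R (y - p)" by (simp add: algebra_simps)
    ultimately have "p + t *\<^sub>R (y - p) \<in> K" using t(3) cU(4) by auto
    from p(3)[OF this] have "t * ((y - p) \<bullet> \<nu>) \<le> 0" by (simp add: inner_add_left)
    then show ?thesis using t(1) by (simp add: mult_le_0_iff inner_diff_left)
  qed
  have \<nu>\<nu>: "\<nu> \<bullet> \<nu> = 1" using \<nu> by (simp add: dot_square_norm)
  have a: "c \<bullet> \<nu> + r \<le> p \<bullet> \<nu>"
    using half[of "c + r *\<^sub>R \<nu>"] r \<nu> \<nu>\<nu> by (simp add: dist_norm inner_add_left)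
  have n: "norm (p - c) = r" using cU(1) by (simp add: dist_norm norm_minus_commute)
  \<comment> \<open>p - c has length r and component at least r along the unit vector \<nu>, which
    leaves only r \<nu>.\<close>
  have "(norm (p - c - r *\<^sub>R \<nu>))\<^sup>2 = (norm (p - c))\<^sup>2 - 2 * r * ((p - c) \<bullet> \<nu>) + r\<^sup>2"
    unfolding power2_norm_eq_inner using \<nu>\<nu> by (simp add: inner_diff_left inner_diff_right inner_commute power2_eq_square algebra_simps)
  also have "\<dots> \<le> 0"
  proof -
    have "r * r \<le> r * ((p - c) \<bullet> \<nu>)" using a r by (intro mult_left_mono) (auto simp: inner_diff_left)
    then show ?thesis using n by (simp add: power2_eq_square)
  qed
  finally have pc: "p = c + r *\<^sub>R \<nu>" by (simp add: algebra_simps)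
  have "((\<lambda>u. c + (r / norm u) *\<^sub>R u) \<longlongrightarrow> c + (r / norm \<nu>) *\<^sub>R \<nu>) (nhds \<nu>)"
    using \<nu> by (intro tendsto_intros) (auto simp: filterlim_ident)
  then have "eventually (\<lambda>u. c + (r / norm u) *\<^sub>R u \<in> U) (nhds \<nu>)"
    using cU(2,3) pc \<nu> by (intro topological_tendstoD) auto
  moreover have "eventually (\<lambda>u. u \<noteq> 0) (nhds \<nu>)" using \<open>\<nu> \<noteq> 0\<close>
    by (rule t1_space_nhds)
  ultimately have "eventually (\<lambda>u. c \<bullet> u + norm u * r \<le> support_fun K u) (nhds \<nu>)"
  proof eventually_elim
    case (elim u)
    have "c + (r / norm u) *\<^sub>R u \<in> K" using elim r cU(4) by (auto simp: dist_norm)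
    from support_fun_ge[OF comp ne this, of u]
    show ?case using elim by (simp add: inner_add_left dot_square_norm power2_eq_square mult.commute)
  qed
  then have "\<exists>e>0. \<forall>u. dist u \<nu> < e \<longrightarrow> c \<bullet> u + norm u * r \<le> support_fun K u"
    unfolding eventually_nhds_metric .
  moreover have "c \<bullet> \<nu> + r = support_fun K \<nu>" using p(2) pc \<nu>\<nu> by (simp add: inner_add_left)
  ultimately show ?thesis unfolding r_def by auto
qed

text \<open>The function \<open>h\<^sub>K - |\<cdot>| / \<lambda>\<close> has a local linear minorant at every nonzero vector, hence is convex
  along segments avoiding the origin, so each local minorant is a global one.\<close>

lemma inner_ball_global:
  fixes K :: "'a::euclidean_space set"
  assumes comp: "compact K" and ne: "K \<noteq> {}" and conc: "lambda_concave lam K" and lam: "lam > 0"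
    and \<nu>: "norm \<nu> = 1" and d: "2 \<le> DIM('a)"
  shows "\<exists>c. c \<bullet> \<nu> + 1 / lam = support_fun K \<nu> \<and> (\<forall>u. c \<bullet> u + norm u / lam \<le> support_fun K u)"
proof -
  let ?h = "support_fun K"
  define g where "g u = ?h u - norm u / lam" for u
  have contg: "continuous_on S g" for S
    unfolding g_def by (intro continuous_intros continuous_support_fun comp ne) (use lam in auto)
  have g_scale: "g (t *\<^sub>R u) = t * g u" if "0 \<le> t" for t u
    unfolding g_def using support_fun_scaleR[OF comp ne that] that by (simp add: algebra_simps)
  \<comment> \<open>Positive homogeneity carries the minorant from x / |x| to x, with the radius of
    its neighbourhood scaled by |x|.\<close>
  have supp: "\<exists>c e. e > 0 \<and> c \<bullet> x = g x \<and> (\<forall>u. dist u x < e \<longrightarrow> c \<bullet> u \<le> g u)" if x: "x \<noteq> 0" for x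
  proof -
    have "norm ((1 / norm x) *\<^sub>R x) = 1" using x by simp
    from local_inner_ball[OF comp ne conc lam this] obtain c e where
      c: "c \<bullet> ((1 / norm x) *\<^sub>R x) + 1 / lam = ?h ((1 / norm x) *\<^sub>R x)" and
      e: "e > 0" "\<And>u. dist u ((1 / norm x) *\<^sub>R x) < e \<Longrightarrow> c \<bullet> u + norm u / lam \<le> ?h u" by blast
    have "c \<bullet> u \<le> g u" if u: "dist u x < e * norm x" for u
    proof -
      have "dist ((1 / norm x) *\<^sub>R u) ((1 / norm x) *\<^sub>R x) = dist u x / norm x"
        by (simp add: dist_norm scaleR_diff_right[symmetric])
      also have "\<dots> < e" using u x by (simp add: field_simps)
      finally have "c \<bullet> ((1 / norm x) *\<^sub>R u) \<le> g ((1 / norm x) *\<^sub>R u)" using e(2) unfolding g_def by force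
      then show ?thesis using g_scale[of "1 / norm x" u] x by (simp add: divide_le_cancel)
    qed
    moreover have "c \<bullet> x = g x"
    proof -
      have "c \<bullet> ((1 / norm x) *\<^sub>R x) = g ((1 / norm x) *\<^sub>R x)" using c x unfolding g_def by simp
      then show ?thesis using g_scale[of "1 / norm x" x] x by simp
    qed
    ultimately show ?thesis using e(1) x by (intro exI[of _ c] exI[of _ "e * norm x"]) auto
  qed
  obtain c e where c: "c \<bullet> \<nu> = g \<nu>" and e: "e > 0" "\<And>u. dist u \<nu> < e \<Longrightarrow> c \<bullet> u \<le> g u"
    using supp[of \<nu>] \<nu> by fastforce
  \<comment> \<open>Along the segment from \<nu> to u, \<open>\<phi>\<close> starts at 0, is
    nonnegative nearby by the local minorant at \<nu>, and lies below its chord, so it cannot end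
    negative.\<close>
  have main: "c \<bullet> u \<le> g u" if u: "\<And>s. 0 \<le> s \<Longrightarrow> s \<le> 1 \<Longrightarrow> (1 - s) *\<^sub>R \<nu> + s *\<^sub>R u \<noteq> 0" for u
  proof -
    define \<gamma> where "\<gamma> s = (1 - s) *\<^sub>R \<nu> + s *\<^sub>R u" for s
    define \<phi> where "\<phi> s = g (\<gamma> s) - c \<bullet> \<gamma> s" for s
    have \<gamma>d: "\<gamma> t = \<gamma> s + (t - s) *\<^sub>R (u - \<nu>)" for s t unfolding \<gamma>_def by (simp add: algebra_simps)
    have cont\<gamma>: "continuous_on S \<gamma>" for S unfolding \<gamma>_def by (intro continuous_intros)
    have cont: "continuous_on {0..1} \<phi>" unfolding \<phi>_def
      by (intro continuous_intros cont\<gamma> continuous_on_compose2[OF contg[of UNIV] cont\<gamma>]) auto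
    have loc: "\<exists>a e. e > 0 \<and> (\<forall>t\<in>{0..1}. \<bar>t - s\<bar> < e \<longrightarrow> \<phi> s + a * (t - s) \<le> \<phi> t)" if s: "0 < s" "s < 1" for s
    proof -
      have "\<gamma> s \<noteq> 0" using u s unfolding \<gamma>_def by simp
      then obtain c' e' where c': "e' > 0" "c' \<bullet> \<gamma> s = g (\<gamma> s)" "\<And>w. dist w (\<gamma> s) < e' \<Longrightarrow> c' \<bullet> w \<le> g w"
        using supp by blast
      have "\<phi> s + ((c' - c) \<bullet> (u - \<nu>)) * (t - s) \<le> \<phi> t" if t: "\<bar>t - s\<bar> < e' / (norm (u - \<nu>) + 1)" for t
      proof -
        have pos: "norm (u - \<nu>) + 1 > 0" by (smt (verit) norm_ge_zero)
        have "dist (\<gamma> t) (\<gamma> s) = \<bar>t - s\<bar> * norm (u - \<nu>)" using \<gamma>d[of t s] by (simp add: dist_norm)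
        also have "\<dots> \<le> \<bar>t - s\<bar> * (norm (u - \<nu>) + 1)" by (intro mult_left_mono) auto
        also have "\<dots> < e'" using t pos by (simp add: pos_less_divide_eq)
        finally have "c' \<bullet> \<gamma> t \<le> g (\<gamma> t)" by (rule c'(3))
        moreover have "a \<bullet> \<gamma> t = a \<bullet> \<gamma> s + (a \<bullet> (u - \<nu>)) * (t - s)" for a
          unfolding \<gamma>d[of t s] by (simp add: inner_add_right)
        ultimately show ?thesis unfolding \<phi>_def c'(2)[symmetric]
          by (simp add: inner_diff_left[of c' c] left_diff_distrib)
      qed
      moreover have "e' / (norm (u - \<nu>) + 1) > 0" using c'(1) by (simp add: add_nonneg_pos)
      ultimately show ?thesis by blast
    qed
    have \<phi>0: "\<phi> 0 = 0" unfolding \<phi>_def \<gamma>_def using c by simp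
    \<comment> \<open>A positive parameter whose point is within e of \<nu>; the added 1 avoids a
      zero denominator for u = \<nu>.\<close>
    define s where "s = min 1 (e / (2 * (norm (u - \<nu>) + 1)))"
    have pos: "norm (u - \<nu>) + 1 > 0" by (smt (verit) norm_ge_zero)
    have s: "0 < s" "s \<le> 1" using e(1) pos unfolding s_def by auto
    have "dist (\<gamma> s) \<nu> = s * norm (u - \<nu>)" using \<gamma>d[of s 0] s by (simp add: dist_norm \<gamma>_def algebra_simps flip: scaleR_diff_right)
    also have "\<dots> \<le> (e / (2 * (norm (u - \<nu>) + 1))) * (norm (u - \<nu>) + 1)"
      unfolding s_def using e(1) pos by (intro mult_mono) auto
    also have "\<dots> = e / 2" using pos by (simp only: divide_divide_eq_left[symmetric] nonzero_eq_divide_eq times_divide_eq_left) simp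
    also have "\<dots> < e" using e(1) by simp
    finally have "0 \<le> \<phi> s" unfolding \<phi>_def using e(2) by simp
    also have "\<phi> s \<le> (1 - s) * \<phi> 0 + s * \<phi> 1"
      by (rule local_affine_minorant_imp_below_chord[OF cont loc]) (use s in auto)
    finally have "0 \<le> \<phi> 1" using s \<phi>0 by (simp add: zero_le_mult_iff)
    then show ?thesis unfolding \<phi>_def \<gamma>_def by simp
  qed
  have "c \<bullet> u \<le> g u" for u
  proof -
    \<comment> \<open>The segment meets the origin exactly when u is a nonpositive multiple of
      \<nu>; dimension at least 2 offers a direction to leave that line.\<close>
    obtain w where w: "w \<noteq> 0" "orthogonal \<nu> w" using orthogonal_to_vector_exists[OF d] by metis
    have nw: "\<nu> \<bullet> w = 0" "w \<bullet> w \<noteq> 0" using w by (auto simp: orthogonal_def)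
    show ?thesis
    proof (cases "\<exists>s. 0 \<le> s \<and> s \<le> 1 \<and> (1 - s) *\<^sub>R \<nu> + s *\<^sub>R u = 0")
      case False
      then show ?thesis using main by blast
    next
      case True
      then obtain s where s: "(1 - s) *\<^sub>R \<nu> + s *\<^sub>R u = 0" by blast
      have "((1 - s) *\<^sub>R \<nu> + s *\<^sub>R u) \<bullet> w = 0" unfolding s by simp
      moreover have "s \<noteq> 0" using s \<nu> by auto
      ultimately have uw: "u \<bullet> w = 0" using nw by (simp add: inner_add_left)
      \<comment> \<open>Moving \<open>u\<close> orthogonally to \<open>\<nu>\<close> frees the segment from the origin.\<close>
      have ineq: "c \<bullet> (u + \<epsilon> *\<^sub>R w) \<le> g (u + \<epsilon> *\<^sub>R w)" if \<epsilon>: "\<epsilon> \<noteq> 0" for \<epsilon>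
      proof (rule main, rule notI)
        fix s assume s: "(1 - s) *\<^sub>R \<nu> + s *\<^sub>R (u + \<epsilon> *\<^sub>R w) = 0"
        have "((1 - s) *\<^sub>R \<nu> + s *\<^sub>R (u + \<epsilon> *\<^sub>R w)) \<bullet> w = 0" unfolding s by simp
        then have "s * (\<epsilon> * (w \<bullet> w)) = 0" using nw uw by (simp add: inner_add_left)
        then have "s = 0" using \<epsilon> nw by simp
        then show False using s \<nu> by auto
      qed
      define x where "x n = u + inverse (real (Suc n)) *\<^sub>R w" for n
      have "x \<longlonglongrightarrow> u + 0 *\<^sub>R w"
        unfolding x_def by (intro tendsto_intros LIMSEQ_inverse_real_of_nat)
      then have x: "x \<longlonglongrightarrow> u" by simp
      have "(\<lambda>n. g (x n)) \<longlonglongrightarrow> g u"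
        using contg[of UNIV] x by (metis UNIV_I continuous_on_eq_continuous_at isCont_tendsto_compose open_UNIV)
      moreover have "(\<lambda>n. c \<bullet> x n) \<longlonglongrightarrow> c \<bullet> u" by (intro tendsto_intros x)
      moreover have "c \<bullet> x n \<le> g (x n)" for n unfolding x_def by (rule ineq) simp
      ultimately show ?thesis using LIMSEQ_le by blast
    qed
  qed
  then show ?thesis using c \<nu> unfolding g_def by (intro exI[of _ c]) (auto simp: algebra_simps)
qed

section \<open>Quermassintegrals of parallel bodies\<close>

text \<open>\<open>L\<close> collects the centres of all balls of radius 1 / \<lambda> inside
  \<open>K\<close>. By \<open>inner_ball_global\<close> one of them touches each supporting
  hyperplane of \<open>K\<close>, so L + r B and \<open>K\<close> cannot be separated.\<close>

lemma lambda_concave_imp_minkowski_summand: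
  fixes K :: "'a::euclidean_space set"
  assumes comp: "compact K" and ne: "K \<noteq> {}" and conv: "convex K"
    and conc: "lambda_concave lam K" and lam: "lam > 0" and d: "2 \<le> DIM('a)"
  shows "\<exists>L. compact L \<and> convex L \<and> L \<noteq> {} \<and> K = minkowski_sum L (cball 0 (1 / lam))"
proof -
  define r where "r = 1 / lam"
  have r: "r > 0" using lam unfolding r_def by simp
  define L where "L = {x. \<forall>y\<in>cball 0 r. x + y \<in> K}"
  have "L = (\<Inter>y\<in>cball 0 r. (+) (- y) ` K)"
  proof -
    have "x + y \<in> K \<longleftrightarrow> x \<in> (+) (- y) ` K" for x y
      by (auto intro: image_eqI[of _ _ "x + y"])
    then show ?thesis unfolding L_def by blast
  qed
  then have "closed L"
    using closed_INT[of "cball 0 r" "\<lambda>y. (+) (- y) ` K"] closed_translation[OF compact_imp_closed[OF comp]]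
    by blast
  moreover have "L \<subseteq> K" unfolding L_def using r by (force dest: bspec[of _ _ 0])
  ultimately have cL: "compact L" using comp by (metis closed_Int_compact inf.absorb1)
  have vL: "convex L"
  proof (rule convexI)
    fix x y and a b :: real assume xy: "x \<in> L" "y \<in> L" "0 \<le> a" "0 \<le> b" "a + b = 1"
    have "a *\<^sub>R x + b *\<^sub>R y + w \<in> K" if "w \<in> cball 0 r" for w
    proof -
      have "a *\<^sub>R (x + w) + b *\<^sub>R (y + w) \<in> K"
        using xy that unfolding L_def by (intro convexD[OF conv]) auto
      moreover have "a *\<^sub>R (x + w) + b *\<^sub>R (y + w) = a *\<^sub>R x + b *\<^sub>R y + (a + b) *\<^sub>R w"
        by (simp add: algebra_simps)
      ultimately show ?thesis using xy by simp
    qed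
    then show "a *\<^sub>R x + b *\<^sub>R y \<in> L" unfolding L_def by blast
  qed
  have sub: "minkowski_sum L (cball 0 r) \<subseteq> K" unfolding minkowski_sum_def L_def by auto
  have touch: "\<exists>c\<in>L. c \<bullet> \<nu> + r = support_fun K \<nu>" if \<nu>: "norm \<nu> = 1" for \<nu>
  proof -
    obtain c where c: "c \<bullet> \<nu> + r = support_fun K \<nu>" "\<And>u. c \<bullet> u + norm u / lam \<le> support_fun K u"
      using inner_ball_global[OF comp ne conc lam \<nu> d] unfolding r_def by blast
    have "c + y \<in> K" if y: "y \<in> cball 0 r" for y
    proof (rule mem_of_inner_le_support_fun[OF comp ne conv])
      fix u
      have "y \<bullet> u \<le> norm y * norm u" by (rule norm_cauchy_schwarz)
      also have "\<dots> \<le> r * norm u" using y by (intro mult_right_mono) auto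
      finally show "(c + y) \<bullet> u \<le> support_fun K u"
        using c(2)[of u] unfolding r_def by (simp add: inner_add_left)
    qed
    then show ?thesis using c(1) unfolding L_def by blast
  qed
  have "K \<subseteq> minkowski_sum L (cball 0 r)"
  proof
    fix x assume x: "x \<in> K"
    show "x \<in> minkowski_sum L (cball 0 r)" (is "x \<in> ?M")
    proof (rule ccontr)
      assume nx: "x \<notin> ?M"
      have M: "convex ?M" "closed ?M"
        by (intro convex_minkowski_sum vL convex_cball)
           (intro compact_imp_closed compact_minkowski_sum cL compact_cball)
      obtain w \<beta> where w: "w \<bullet> x < \<beta>" "\<And>z. z \<in> ?M \<Longrightarrow> \<beta> < w \<bullet> z"
        using separating_hyperplane_closed_point[OF M nx] by blast
      \<comment> \<open>Provides a point of \<open>?M\<close>, without which the separation would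
        admit w = 0.\<close>
      obtain e :: 'a where "norm e = 1" by (metis ex_in_conv nonempty_Basis norm_Basis)
      then obtain c0 where "c0 \<in> L" using touch by blast
      then have "c0 + 0 \<in> ?M" unfolding minkowski_sum_def using r by force
      then have w0: "w \<noteq> 0" using w(1) w(2) by force
      \<comment> \<open>\<open>w\<close> points from x towards \<open>?M\<close>, so x sticks out in
        the opposite direction.\<close>
      define \<nu> where "\<nu> = (- 1 / norm w) *\<^sub>R w"
      have \<nu>: "norm \<nu> = 1" unfolding \<nu>_def using w0 by simp
      then have \<nu>\<nu>: "\<nu> \<bullet> \<nu> = 1" by (simp add: dot_square_norm)
      obtain c where c: "c \<in> L" "c \<bullet> \<nu> + r = support_fun K \<nu>" using touch[OF \<nu>] by blast
      have "c + r *\<^sub>R \<nu> \<in> ?M" unfolding minkowski_sum_def using c r \<nu> by force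
      then have "w \<bullet> x < w \<bullet> (c + r *\<^sub>R \<nu>)" using w by force
      then have "(c + r *\<^sub>R \<nu>) \<bullet> \<nu> < x \<bullet> \<nu>"
        unfolding \<nu>_def using w0 by (simp add: inner_commute[of _ w] divide_strict_right_mono)
      then have "support_fun K \<nu> < x \<bullet> \<nu>" using c \<nu>\<nu> by (simp add: inner_add_left)
      then show False using support_fun_ge[OF comp ne x, of \<nu>] by simp
    qed
  qed
  then have "K = minkowski_sum L (cball 0 r)" using sub by blast
  moreover have "L \<noteq> {}" using ne calculation by force
  ultimately show ?thesis using cL vL unfolding r_def by blast
qed

text \<open>The sum is convex and contains both balls; conversely a vector y of the ball is
  distributed over both ends, as (1 - t)(a + y) + t (b + y).\<close>

lemma sausage_eq_minkowski_sum:
  fixes a b :: "'a::euclidean_space"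
  shows "convex hull (cball a r \<union> cball b r) = minkowski_sum (closed_segment a b) (cball 0 r)"
proof (intro equalityI subsetI)
  fix x assume "x \<in> convex hull (cball a r \<union> cball b r)"
  moreover have "convex hull (cball a r \<union> cball b r) \<subseteq> minkowski_sum (closed_segment a b) (cball 0 r)"
  proof (rule hull_minimal)
    have "y \<in> minkowski_sum (closed_segment a b) (cball 0 r)" if "y \<in> cball c r" "c \<in> closed_segment a b" for y c
    proof -
      have "y = c + (y - c)" "y - c \<in> cball 0 r" using that by (auto simp: dist_norm norm_minus_commute)
      then show ?thesis unfolding minkowski_sum_def using that by blast
    qed
    then show "cball a r \<union> cball b r \<subseteq> minkowski_sum (closed_segment a b) (cball 0 r)"
      using ends_in_segment by blast
  qed (auto intro: convex_minkowski_sum)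
  ultimately show "x \<in> minkowski_sum (closed_segment a b) (cball 0 r)" by blast
next
  fix x assume "x \<in> minkowski_sum (closed_segment a b) (cball 0 r)"
  then obtain t y where t: "0 \<le> t" "t \<le> 1" "norm y \<le> r" "x = (1 - t) *\<^sub>R a + t *\<^sub>R b + y"
    unfolding minkowski_sum_def closed_segment_def by auto
  have "x = (1 - t) *\<^sub>R (a + y) + t *\<^sub>R (b + y)" unfolding t(4) by (simp add: algebra_simps)
  also have "\<dots> \<in> convex hull (cball a r \<union> cball b r)"
    using t by (intro convexD[OF convex_convex_hull] hull_inc) (auto simp: dist_norm)
  finally show "x \<in> convex hull (cball a r \<union> cball b r)" .
qed

text \<open>Resolves the definite description: a polynomial is determined by its values on t \<ge>
  0, and the clause for indices above d fixes the tail of the sequence.\<close>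

lemma quermass_eq:
  fixes K :: "'a::euclidean_space set"
  assumes p: "steiner K p" and i: "i \<le> DIM('a)"
  shows "quermass K i = coeff p i / real (DIM('a) choose i)"
proof -
  define W where "W i = (if i \<le> DIM('a) then coeff p i / real (DIM('a) choose i) else 0)" for i
  have "quermass K = W"
    unfolding quermass_def
  proof (rule the_equality)
    have "(\<Sum>i\<le>DIM('a). real (DIM('a) choose i) * W i * t ^ i) = (\<Sum>i\<le>DIM('a). coeff p i * t ^ i)" for t
      unfolding W_def by (rule sum.cong) auto
    then show "(\<forall>i>DIM('a). W i = 0) \<and> (\<forall>t\<ge>0. measure lebesgue (minkowski_sum K (cball 0 t)) =
        (\<Sum>i\<le>DIM('a). real (DIM('a) choose i) * W i * t ^ i))"
      using p poly_eq_sum_coeff[of p "DIM('a)"] unfolding steiner_def W_def by auto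
  next
    fix V :: "nat \<Rightarrow> real"
    assume V: "(\<forall>i>DIM('a). V i = 0) \<and> (\<forall>t\<ge>0. measure lebesgue (minkowski_sum K (cball 0 t)) =
        (\<Sum>i\<le>DIM('a). real (DIM('a) choose i) * V i * t ^ i))"
    define q where "q = (\<Sum>i\<le>DIM('a). monom (real (DIM('a) choose i) * V i) i)"
    have "p = q"
      by (rule poly_eqI_nonneg) (use V p in \<open>simp add: steiner_def q_def poly_sum poly_monom\<close>)
    moreover have "coeff q i = real (DIM('a) choose i) * V i" if "i \<le> DIM('a)" for i
      unfolding q_def coeff_sum using that by (simp add: coeff_monom sum.delta)
    ultimately show "V = W"
      unfolding W_def using V by (auto simp: fun_eq_iff)
  qed
  then show ?thesis using i unfolding W_def by simp
qed

text \<open>The volume of L + r B + t B is p(r + t), expanded by the binomial theorem; the inner sum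
  runs up to d because \<open>m choose i\<close> vanishes for i > m.\<close>

lemma steiner_add_cball:
  fixes L :: "'a::euclidean_space set"
  assumes p: "steiner L p" and r: "0 \<le> r"
  shows "steiner (minkowski_sum L (cball 0 r))
     (\<Sum>i\<le>DIM('a). monom (\<Sum>m\<le>DIM('a). coeff p m * (real (m choose i) * r ^ (m - i))) i)"
    (is "steiner _ ?q")
proof -
  let ?d = "DIM('a)"
  have "degree ?q \<le> ?d"
    by (rule degree_sum_le) (auto intro: degree_monom_le[THEN order_trans])
  moreover have "vol (minkowski_sum (minkowski_sum L (cball 0 r)) (cball 0 t)) = poly ?q t" if t: "0 \<le> t" for t
  proof -
    have "vol (minkowski_sum (minkowski_sum L (cball 0 r)) (cball 0 t)) = poly p (r + t)"
      using p r t unfolding minkowski_sum_assoc minkowski_sum_cball[OF r t] steiner_def by simp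
    also have "\<dots> = (\<Sum>m\<le>?d. coeff p m * (t + r) ^ m)"
      using p poly_eq_sum_coeff[of p ?d "r + t"] unfolding steiner_def by (simp add: add.commute)
    also have "\<dots> = (\<Sum>m\<le>?d. \<Sum>i\<le>?d. coeff p m * (real (m choose i) * r ^ (m - i)) * t ^ i)"
    proof (rule sum.cong[OF refl])
      fix m assume m: "m \<in> {..?d}"
      have "(t + r) ^ m = (\<Sum>i\<le>m. real (m choose i) * t ^ i * r ^ (m - i))" by (rule binomial_ring)
      also have "\<dots> = (\<Sum>i\<le>?d. real (m choose i) * t ^ i * r ^ (m - i))"
        using m by (intro sum.mono_neutral_left) (auto simp: not_le binomial_eq_0)
      finally show "coeff p m * (t + r) ^ m = (\<Sum>i\<le>?d. coeff p m * (real (m choose i) * r ^ (m - i)) * t ^ i)"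
        by (simp add: sum_distrib_left mult_ac)
    qed
    also have "\<dots> = poly ?q t"
      unfolding poly_sum poly_monom sum_distrib_right by (rule sum.swap)
    finally show ?thesis .
  qed
  ultimately show ?thesis unfolding steiner_def by blast
qed

text \<open>The identity (d choose m)(m choose i) = (d choose i)(d - i choose m - i) confines the
  dependence on i to one binomial in x = d - i. The inequality thereby becomes convexity in
  x.\<close>

lemma scaled_quermass_add_cball:
  fixes L :: "'a::euclidean_space set"
  assumes p: "steiner L p" and lam: "0 < lam" and i: "i \<le> DIM('a)"
  shows "quermass (minkowski_sum L (cball 0 (1 / lam))) i / lam ^ i
     = (\<Sum>m\<le>DIM('a). coeff p m / (lam ^ m * real (DIM('a) choose m)) * real ((DIM('a) - i) choose (DIM('a) - m)))"
proof -
  let ?d = "DIM('a)"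
  define r where "r = 1 / lam"
  have r: "0 \<le> r" using lam unfolding r_def by simp
  have "quermass (minkowski_sum L (cball 0 r)) i
      = (\<Sum>m\<le>?d. coeff p m * (real (m choose i) * r ^ (m - i))) / real (?d choose i)"
    unfolding quermass_eq[OF steiner_add_cball[OF p r] i] using i by (simp add: coeff_sum coeff_monom sum.delta)
  then have "quermass (minkowski_sum L (cball 0 r)) i / lam ^ i
      = (\<Sum>m\<le>?d. coeff p m * (real (m choose i) * r ^ (m - i)) / real (?d choose i) / lam ^ i)"
    by (simp add: sum_divide_distrib)
  also have "\<dots> = (\<Sum>m\<le>?d. coeff p m / (lam ^ m * real (?d choose m)) * real ((?d - i) choose (?d - m)))"
  proof (rule sum.cong[OF refl])
    fix m assume "m \<in> {..?d}"
    then have m: "m \<le> ?d" by simp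
    show "coeff p m * (real (m choose i) * r ^ (m - i)) / real (?d choose i) / lam ^ i
        = coeff p m / (lam ^ m * real (?d choose m)) * real ((?d - i) choose (?d - m))"
    proof (cases "i \<le> m")
      \<comment> \<open>For m < i the exponent \<open>m - i\<close> is truncated to 0; both sides
        vanish through their binomials.\<close>
      case False
      then have "m choose i = 0" "(?d - i) choose (?d - m) = 0" using i m by (auto intro!: binomial_eq_0)
      then show ?thesis by (simp only: of_nat_0 mult_zero_left mult_zero_right div_0)
    next
      case True
      have "(?d choose m) * (m choose i) = (?d choose i) * ((?d - i) choose (m - i))"
        using choose_mult[OF True m] .
      also have "(?d - i) choose (m - i) = (?d - i) choose (?d - m)"
        using binomial_symmetric[of "m - i" "?d - i"] True m by simp
      finally have "real (?d choose m) * real (m choose i) = real (?d choose i) * real ((?d - i) choose (?d - m))"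
        by (metis of_nat_mult)
      then have "real (m choose i) / real (?d choose i) = real ((?d - i) choose (?d - m)) / real (?d choose m)"
        using i m by (simp add: divide_simps mult_ac)
      moreover have "r ^ (m - i) / lam ^ i = 1 / lam ^ m"
        unfolding r_def power_one_over using True lam by (simp add: power_add[symmetric])
      ultimately have "coeff p m * ((real (m choose i) / real (?d choose i)) * (r ^ (m - i) / lam ^ i))
          = coeff p m * ((real ((?d - i) choose (?d - m)) / real (?d choose m)) * (1 / lam ^ m))" by simp
      then show ?thesis by (simp add: mult_ac)
    qed
  qed
  finally show ?thesis unfolding r_def .
qed

section \<open>Convexity of binomial coefficients in the upper argument\<close>

text \<open>For x < y < z this is (y - x)(z - y)(z - x) times the second divided difference of n
  \<mapsto> (n choose q), a form without denominators.\<close>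

definition choose_defect :: "nat \<Rightarrow> nat \<Rightarrow> nat \<Rightarrow> nat \<Rightarrow> real" where
  "choose_defect x y z q = (real y - real x) * real (z choose q) + (real x - real z) * real (y choose q)
     + (real z - real y) * real (x choose q)"

lemma choose_mono_left: "y \<le> z \<Longrightarrow> y choose q \<le> z choose q"
proof (induction z rule: dec_induct)
  case (step n)
  have "n choose q \<le> Suc n choose q" by (cases q) auto
  then show ?case using step.IH by linarith
qed simp

text \<open>By Pascal's rule the increment at n is \<open>n choose q\<close>, which is at least
  \<open>y choose q\<close> from y on: a supporting line at y, seen to the right.\<close>

lemma choose_Suc_ge: "y \<le> z \<Longrightarrow> (y choose Suc q) + (z - y) * (y choose q) \<le> z choose Suc q"
proof (induction z rule: dec_induct)
  case (step n)
  then show ?case using choose_mono_left[of y n q] by (simp add: Suc_diff_le)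
qed simp

text \<open>The same supporting line to the left of y, where the increments are at most
  \<open>y choose q\<close>.\<close>

lemma choose_Suc_le: "x \<le> y \<Longrightarrow> y choose Suc q \<le> (x choose Suc q) + (y - x) * (y choose q)"
proof (induction y rule: dec_induct)
  case (step n)
  have le: "n choose q \<le> Suc n choose q" by (rule choose_mono_left) simp
  then have "(n - x) * (n choose q) \<le> (n - x) * (Suc n choose q)" by simp
  moreover have "Suc n choose Suc q = (n choose q) + (n choose Suc q)" by simp
  moreover have "(Suc n - x) * (Suc n choose q) = (Suc n choose q) + (n - x) * (Suc n choose q)"
    using step.hyps by (simp add: Suc_diff_le)
  ultimately show ?case using step.IH le by linarith
qed simp

text \<open>Both one-sided bounds at y use the slope \<open>y choose k\<close>; weighted by z - y
  and y - x, the slope terms cancel in the sum.\<close>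

lemma choose_defect_nonneg:
  assumes "x < y" "y < z"
  shows "0 \<le> choose_defect x y z q"
proof (cases q)
  case (Suc k)
  have "real (y choose q) + (real z - real y) * real (y choose k) \<le> real (z choose q)"
    using choose_Suc_ge[of y z k] assms Suc by (metis less_imp_le of_nat_add of_nat_diff of_nat_le_iff of_nat_mult)
  then have "(real y - real x) * (real (y choose q) + (real z - real y) * real (y choose k)) \<le> (real y - real x) * real (z choose q)"
    using assms by (intro mult_left_mono) auto
  moreover have "real (y choose q) \<le> real (x choose q) + (real y - real x) * real (y choose k)"
    using choose_Suc_le[of x y k] assms Suc by (metis less_imp_le of_nat_add of_nat_diff of_nat_le_iff of_nat_mult)
  then have "(real z - real y) * real (y choose q) \<le> (real z - real y) * (real (x choose q) + (real y - real x) * real (y choose k))"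
    using assms by (intro mult_left_mono) auto
  ultimately show ?thesis unfolding choose_defect_def by (simp add: algebra_simps)
qed (simp add: choose_defect_def)

lemma choose_defect_le_1: "q \<le> 1 \<Longrightarrow> choose_defect x y z q = 0"
  unfolding choose_defect_def by (cases q) (auto simp: algebra_simps)

text \<open>For the quadratic n (n - 1) / 2 the defect is half the Vandermonde product of x, y,
  z.\<close>

lemma choose_defect_2_pos:
  assumes "x < y" "y < z"
  shows "0 < choose_defect x y z 2"
proof -
  have two: "real (n choose 2) = real n * (real n - 1) / 2" for n
    by (induction n) (auto simp: numeral_2_eq_2 field_simps)
  have "choose_defect x y z 2 = (real y - real x) * (real z - real y) * (real z - real x) / 2"
    unfolding choose_defect_def two by (simp add: field_simps)
  moreover have "0 < (real y - real x) * (real z - real y) * (real z - real x)"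
    using assms by (intro mult_pos_pos) auto
  ultimately show ?thesis by simp
qed

text \<open>Passing from i to d - i reverses the order, so k - j = (d - j) - (d - k) and the three
  weights are those of the defect at d - k < d - j < d - i.\<close>

lemma quermass_defect:
  fixes L :: "'a::euclidean_space set"
  assumes p: "steiner L p" and lam: "0 < lam" and ijk: "i < j" "j < k" "k \<le> DIM('a)"
    and K: "K = minkowski_sum L (cball 0 (1 / lam))"
  shows "(real k - real j) * (quermass K i / lam ^ i) + (real i - real k) * (quermass K j / lam ^ j)
       + (real j - real i) * (quermass K k / lam ^ k)
     = (\<Sum>m\<le>DIM('a). coeff p m / (lam ^ m * real (DIM('a) choose m))
          * choose_defect (DIM('a) - k) (DIM('a) - j) (DIM('a) - i) (DIM('a) - m))"
proof -
  let ?d = "DIM('a)"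
  have le: "i \<le> DIM('a)" "j \<le> DIM('a)" "k \<le> DIM('a)" using ijk by auto
  show ?thesis
    unfolding K scaled_quermass_add_cball[OF p lam le(1)] scaled_quermass_add_cball[OF p lam le(2)]
      scaled_quermass_add_cball[OF p lam le(3)] choose_defect_def
    unfolding sum_distrib_left sum.distrib[symmetric]
  proof (rule sum.cong[OF refl])
    fix m
    have "(real k - real j) * (e * A) + (real i - real k) * (e * B) + (real j - real i) * (e * C)
        = e * ((real (?d - j) - real (?d - k)) * A + (real (?d - k) - real (?d - i)) * B
          + (real (?d - i) - real (?d - j)) * C)" for e A B C
      using le by (simp add: of_nat_diff algebra_simps)
    then show "(real k - real j) * (coeff p m / (lam ^ m * real (?d choose m)) * real (?d - i choose (?d - m)))
      + (real i - real k) * (coeff p m / (lam ^ m * real (?d choose m)) * real (?d - j choose (?d - m)))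
      + (real j - real i) * (coeff p m / (lam ^ m * real (?d choose m)) * real (?d - k choose (?d - m)))
      = coeff p m / (lam ^ m * real (?d choose m)) *
        ((real (?d - j) - real (?d - k)) * real (?d - i choose (?d - m))
          + (real (?d - k) - real (?d - i)) * real (?d - j choose (?d - m))
          + (real (?d - i) - real (?d - j)) * real (?d - k choose (?d - m)))" .
  qed
qed

theorem theoremA:
  fixes K :: "'a::euclidean_space set" and lam :: real
  assumes "DIM('a) \<ge> 2" and "lam > 0"
    and "convex_body K" and "lambda_concave lam K"
  shows "\<forall>i j k. i < j \<and> j < k \<and> k \<le> DIM('a) \<longrightarrow>
      ((real k - real j) * (quermass K i / lam ^ i)
       + (real i - real k) * (quermass K j / lam ^ j)
       + (real j - real i) * (quermass K k / lam ^ k) \<ge> 0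
     \<and> ((real k - real j) * (quermass K i / lam ^ i)
       + (real i - real k) * (quermass K j / lam ^ j)
       + (real j - real i) * (quermass K k / lam ^ k) = 0 \<longleftrightarrow> lambda_sausage lam K))"
proof (intro allI impI)
  fix i j k :: nat assume "i < j \<and> j < k \<and> k \<le> DIM('a)"
  then have ijk: "i < j" "j < k" "k \<le> DIM('a)" by auto
  let ?d = "DIM('a)"
  let ?E = "(real k - real j) * (quermass K i / lam ^ i) + (real i - real k) * (quermass K j / lam ^ j)
       + (real j - real i) * (quermass K k / lam ^ k)"
  let ?T = "choose_defect (?d - k) (?d - j) (?d - i)"
  have less: "?d - k < ?d - j" "?d - j < ?d - i" using ijk by auto
  have K: "compact K" "convex K" "K \<noteq> {}"
    using assms(3) interior_subset unfolding convex_body_def by auto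
  obtain L where L: "compact L" "convex L" "L \<noteq> {}" "K = minkowski_sum L (cball 0 (1 / lam))"
    using lambda_concave_imp_minkowski_summand[OF K(1,3,2) assms(4,2,1)] by blast
  obtain p where p: "steiner L p" using steiner_exists[OF L(1,2)] by blast
  define e where "e m = coeff p m / (lam ^ m * real (?d choose m)) * ?T (?d - m)" for m
  have E: "?E = (\<Sum>m\<le>?d. e m)"
    unfolding e_def by (rule quermass_defect[OF p assms(2) ijk L(4)])
  have e: "0 \<le> e m" if "m \<le> ?d" for m
    unfolding e_def using steiner_coeff_nonneg[OF L(1,2) p] choose_defect_nonneg[OF less] assms(2)
    by (intro mult_nonneg_nonneg divide_nonneg_nonneg) auto
  have "?E \<ge> 0" unfolding E by (intro sum_nonneg e) simp
  moreover have "lambda_sausage lam K" if "?E = 0"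
  proof -
    \<comment> \<open>A vanishing sum of nonnegative terms; the term at d - 2 carries the strictly
      positive defect for q = 2.\<close>
    have "e (?d - 2) = 0"
      using that e unfolding E by (subst (asm) sum_nonneg_eq_0_iff) auto
    moreover have "?d - (?d - 2) = 2" using assms(1) by simp
    ultimately have "coeff p (?d - 2) = 0"
      using choose_defect_2_pos[OF less] assms(2) unfolding e_def by auto
    then have "collinear L"
      using steiner_coeff_pos_of_not_collinear[OF L(1,2) _ assms(1) p] by force
    then obtain a b where "L = closed_segment a b"
      using compact_convex_collinear_segment L by metis
    then show ?thesis unfolding lambda_sausage_def sausage_eq_minkowski_sum using L(4) by blast
  qed
  moreover have "?E = 0" if "lambda_sausage lam K"
  proof -
    \<comment> \<open>The segment itself serves as the summand in \<open>quermass_defect\<close>, so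
      it need not be identified with \<open>L\<close>.\<close>
    obtain a b where ab: "K = minkowski_sum (closed_segment a b) (cball 0 (1 / lam))"
      using \<open>lambda_sausage lam K\<close> unfolding lambda_sausage_def sausage_eq_minkowski_sum by blast
    obtain q where q: "steiner (closed_segment a b) q"
      using steiner_exists[OF compact_segment convex_closed_segment] by blast
    have "coeff q m / (lam ^ m * real (?d choose m)) * ?T (?d - m) = 0" if "m \<le> ?d" for m
    proof (cases "m + 2 \<le> ?d")
      case True
      then show ?thesis using steiner_segment_coeff_0[OF q] by simp
    next
      case False
      then have "?d - m \<le> 1" by simp
      then show ?thesis using choose_defect_le_1 by simp
    qed
    then show ?thesis unfolding quermass_defect[OF q assms(2) ijk ab] by (intro sum.neutral) auto
  qed
  ultimately show "?E \<ge> 0 \<and> (?E = 0 \<longleftrightarrow> lambda_sausage lam K)" by blast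
qed

end
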